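(* Let $R$ be a commutative unital ring, $a \in R$, $n \in \mathbb{N}$, and let $\mathcal{TL} = \mathcal{TL}_n(a)$ be the Temperley--Lieb algebra on $n$ strands. The cellular Davis complex $(\mathcal{TL}\mathfrak{D}, \delta)$ of $\mathcal{TL}$ is a contractible chain complex of left $\mathcal{TL}$-modules with $H_0(\mathcal{TL}\mathfrak{D}, \delta) = \mathds{1}$; that is, $H_\alpha(\mathcal{TL}\mathfrak{D}, \delta) = 0$ for all $\alpha > 0$, and $H_0(\mathcal{TL}\mathfrak{D}, \delta) \cong \mathds{1}$ as left $\mathcal{TL}$-modules, where $\mathds{1}$ is the trivial module.
   Context: Let $R$ be a commutative unital ring, $a \in R$ and $n \in \mathbb{N}$. The Temperley--Lieb algebra $\mathcal{TL}_n(a)$ is the associative unital $R$-algebra with generators $U_1, \dots, U_{n-1}$ and relations: (1) $U_iU_j = U_jU_i$ if $|i-j| \geq 2$; (2) $U_iU_jU_i = U_i$ if $j = i \pm 1$; (3) $U_i^2 = aU_i$ for all $i$. In particular $\mathcal{TL}_0(a) = \mathcal{TL}_1(a) = R$. The trivial module $\mathds{1}$ is $R$ regarded as a $\mathcal{TL}_n(a)$-module via the $R$-algebra augmentation $\mathcal{TL}_n(a) \to R$ sending every $U_i$ to $0$. Write $\langle n-1\rangle = \{1, \dots, n-1\}$. A (possibly empty) subset $F \subseteq \langle n-1\rangle$ is called innermost if $|i-j| \geq 2$ for all $i \neq j$ in $F$. For an innermost set $F$, the generators $U_i$, $i \in F$, commute pairwise, and $\operatorname{Cup}(F)$ denotes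 the left $\mathcal{TL}$-submodule $\mathcal{TL}\cdot \prod_{i \in F} U_i$ of $\mathcal{TL}$ (so $\operatorname{Cup}(\emptyset) = \mathcal{TL}$). If $F' \subseteq F$ then $\operatorname{Cup}(F) \subseteq \operatorname{Cup}(F')$. The cellular Davis complex $(\mathcal{TL}\mathfrak{D}, \delta)$ is the chain complex of left $\mathcal{TL}$-modules, concentrated in degrees $\alpha \geq 0$, with $$\mathcal{TL}\mathfrak{D}_\alpha = \bigoplus_{F \subseteq \langle n-1\rangle \text{ innermost},\ |F| = \alpha} \operatorname{Cup}(F),$$ whose differential $\delta_\alpha: \mathcal{TL}\mathfrak{D}_\alpha \to \mathcal{TL}\mathfrak{D}_{\alpha-1}$ is given on the summand $\operatorname{Cup}(F)$ by $$A \mapsto \sum_{s \in F} (-1)^{\gamma_F(s)} \iota_F^{F_s}(A),$$ where $F_s = F \setminus \{s\}$, $\iota_F^{F_s}: \operatorname{Cup}(F) \hookrightarrow \operatorname{Cup}(F_s) \subseteq \mathcal{TL}\mathfrak{D}_{\alpha-1}$ is the inclusion (into the summand indexed by $F_s$), and $\gamma_F(s) = |\{s' \in F : s' < s\}|$. *)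

theory Defs
  imports "HOL-Algebra.QuotRing" "HOL-Algebra.Module"
begin

section \<open>Left modules over a possibly noncommutative ring\<close>

text \<open>The library locale \<^locale>\<open>module\<close> demands a commutative base ring. We keep its record type
  and its axioms, but over an arbitrary unital ring. The fields \<^const>\<open>mult\<close> and \<^const>\<open>one\<close>
  of a module record carry no meaning.\<close>

locale left_module = A?: ring A + M?: abelian_group M
  for A :: "('a, 'i) ring_scheme" (structure) and M :: "('a, 'b, 'j) module_scheme" (structure) +
  assumes smult_closed [simp, intro]:
      "\<lbrakk>a \<in> carrier A; x \<in> carrier M\<rbrakk> \<Longrightarrow> a \<odot>\<^bsub>M\<^esub> x \<in> carrier M"
    and smult_l_distr:
      "\<lbrakk>a \<in> carrier A; b \<in> carrier A; x \<in> carrier M\<rbrakk> \<Longrightarrow>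
        (a \<oplus> b) \<odot>\<^bsub>M\<^esub> x = a \<odot>\<^bsub>M\<^esub> x \<oplus>\<^bsub>M\<^esub> b \<odot>\<^bsub>M\<^esub> x"
    and smult_r_distr:
      "\<lbrakk>a \<in> carrier A; x \<in> carrier M; y \<in> carrier M\<rbrakk> \<Longrightarrow>
        a \<odot>\<^bsub>M\<^esub> (x \<oplus>\<^bsub>M\<^esub> y) = a \<odot>\<^bsub>M\<^esub> x \<oplus>\<^bsub>M\<^esub> a \<odot>\<^bsub>M\<^esub> y"
    and smult_assoc1:
      "\<lbrakk>a \<in> carrier A; b \<in> carrier A; x \<in> carrier M\<rbrakk> \<Longrightarrow>
        (a \<otimes> b) \<odot>\<^bsub>M\<^esub> x = a \<odot>\<^bsub>M\<^esub> (b \<odot>\<^bsub>M\<^esub> x)"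
    and smult_one [simp]:
      "x \<in> carrier M \<Longrightarrow> \<one> \<odot>\<^bsub>M\<^esub> x = x"

definition left_module_hom ::
  "('a, 'i) ring_scheme \<Rightarrow> ('a, 'b, 'j) module_scheme \<Rightarrow> ('a, 'c, 'k) module_scheme \<Rightarrow> ('b \<Rightarrow> 'c) set"
  where "left_module_hom A M N = {h \<in> carrier M \<rightarrow> carrier N.
    (\<forall>x\<in>carrier M. \<forall>y\<in>carrier M. h (x \<oplus>\<^bsub>M\<^esub> y) = h x \<oplus>\<^bsub>N\<^esub> h y) \<and>
    (\<forall>a\<in>carrier A. \<forall>x\<in>carrier M. h (a \<odot>\<^bsub>M\<^esub> x) = a \<odot>\<^bsub>N\<^esub> h x)}"

definition left_module_isomorphic ::
  "('a, 'i) ring_scheme \<Rightarrow> ('a, 'b, 'j) module_scheme \<Rightarrow> ('a, 'c, 'k) module_scheme \<Rightarrow> bool"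
  where "left_module_isomorphic A M N \<longleftrightarrow> left_module A M \<and> left_module A N \<and>
    (\<exists>h\<in>left_module_hom A M N. bij_betw h (carrier M) (carrier N))"

definition regular_module :: "('a, 'i) ring_scheme \<Rightarrow> ('a, 'a) module"
  where "regular_module A =
    \<lparr>carrier = carrier A, mult = mult A, one = one A, zero = zero A, add = add A, smult = mult A\<rparr>"

definition quotient_module :: "('a, 'b, 'j) module_scheme \<Rightarrow> 'b set \<Rightarrow> ('a, 'b set) module"
  where "quotient_module M N =
    \<lparr>carrier = a_rcosets\<^bsub>M\<^esub> N, mult = undefined, one = undefined, zero = N, add = set_add M,
     smult = (\<lambda>a X. \<Union>x\<in>X. N +>\<^bsub>M\<^esub> (a \<odot>\<^bsub>M\<^esub> x))\<rparr>"

definition direct_sum_module ::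
  "'i set \<Rightarrow> ('i \<Rightarrow> ('a, 'b, 'j) module_scheme) \<Rightarrow> ('a, 'i \<Rightarrow> 'b) module"
  where "direct_sum_module I M =
    \<lparr>carrier = {x \<in> \<Pi>\<^sub>E i\<in>I. carrier (M i). finite {i \<in> I. x i \<noteq> \<zero>\<^bsub>M i\<^esub>}},
     mult = undefined, one = undefined,
     zero = (\<lambda>i\<in>I. \<zero>\<^bsub>M i\<^esub>),
     add = (\<lambda>x y. \<lambda>i\<in>I. x i \<oplus>\<^bsub>M i\<^esub> y i),
     smult = (\<lambda>a x. \<lambda>i\<in>I. a \<odot>\<^bsub>M i\<^esub> x i)\<rparr>"

definition direct_sum_inj ::
  "'i set \<Rightarrow> ('i \<Rightarrow> ('a, 'b, 'j) module_scheme) \<Rightarrow> 'i \<Rightarrow> 'b \<Rightarrow> 'i \<Rightarrow> 'b"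
  where "direct_sum_inj I M i x = (\<lambda>j\<in>I. if j = i then x else \<zero>\<^bsub>M j\<^esub>)"


section \<open>Chain complexes and homology\<close>

definition left_chain_complex ::
  "('a, 'i) ring_scheme \<Rightarrow> (int \<Rightarrow> ('a, 'b, 'j) module_scheme) \<Rightarrow> (int \<Rightarrow> 'b \<Rightarrow> 'b) \<Rightarrow> bool"
  where "left_chain_complex A C d \<longleftrightarrow>
    (\<forall>i. left_module A (C i)) \<and>
    (\<forall>i. d i \<in> left_module_hom A (C i) (C (i - 1))) \<and>
    (\<forall>i. \<forall>x\<in>carrier (C i). d (i - 1) (d i x) = \<zero>\<^bsub>C (i - 1 - 1)\<^esub>)"

definition cycles ::
  "(int \<Rightarrow> ('a, 'b, 'j) module_scheme) \<Rightarrow> (int \<Rightarrow> 'b \<Rightarrow> 'b) \<Rightarrow> int \<Rightarrow> 'b set"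
  where "cycles C d i = {x \<in> carrier (C i). d i x = \<zero>\<^bsub>C (i - 1)\<^esub>}"

definition boundaries ::
  "(int \<Rightarrow> ('a, 'b, 'j) module_scheme) \<Rightarrow> (int \<Rightarrow> 'b \<Rightarrow> 'b) \<Rightarrow> int \<Rightarrow> 'b set"
  where "boundaries C d i = d (i + 1) ` carrier (C (i + 1))"

definition homology_module ::
  "(int \<Rightarrow> ('a, 'b, 'j) module_scheme) \<Rightarrow> (int \<Rightarrow> 'b \<Rightarrow> 'b) \<Rightarrow> int \<Rightarrow> ('a, 'b set) module"
  where "homology_module C d i =
    quotient_module ((C i)\<lparr>carrier := cycles C d i\<rparr>) (boundaries C d i)"


section \<open>The free associative unital algebra\<close>

text \<open>The free algebra on \<open>X\<close> has the words over \<open>X\<close> as a basis; an element is represented by its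
  finitely supported coefficient function, and multiplication is induced by concatenation.\<close>

definition free_algebra :: "('r, 'm) ring_scheme \<Rightarrow> 'x set \<Rightarrow> ('x list \<Rightarrow> 'r) ring"
  where "free_algebra R X =
    \<lparr>carrier = {f. (\<forall>w. f w \<in> carrier R) \<and> finite {w. f w \<noteq> \<zero>\<^bsub>R\<^esub>} \<and> {w. f w \<noteq> \<zero>\<^bsub>R\<^esub>} \<subseteq> lists X},
     mult = (\<lambda>f g w. \<Oplus>\<^bsub>R\<^esub>k\<in>{..length w}. f (take k w) \<otimes>\<^bsub>R\<^esub> g (drop k w)),
     one = (\<lambda>w. if w = [] then \<one>\<^bsub>R\<^esub> else \<zero>\<^bsub>R\<^esub>),
     zero = (\<lambda>w. \<zero>\<^bsub>R\<^esub>),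
     add = (\<lambda>f g w. f w \<oplus>\<^bsub>R\<^esub> g w)\<rparr>"

definition free_scalar :: "('r, 'm) ring_scheme \<Rightarrow> 'r \<Rightarrow> 'x list \<Rightarrow> 'r"
  where "free_scalar R r = (\<lambda>w. if w = [] then r else \<zero>\<^bsub>R\<^esub>)"

definition free_gen :: "('r, 'm) ring_scheme \<Rightarrow> 'x \<Rightarrow> 'x list \<Rightarrow> 'r"
  where "free_gen R i = (\<lambda>w. if w = [i] then \<one>\<^bsub>R\<^esub> else \<zero>\<^bsub>R\<^esub>)"


section \<open>The Temperley--Lieb algebra\<close>

definition TL_relators :: "('r, 'm) ring_scheme \<Rightarrow> nat \<Rightarrow> 'r \<Rightarrow> (nat list \<Rightarrow> 'r) set"
  where "TL_relators R n a = (let A = free_algebra R {1..<n}; u = free_gen R in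
     {u i \<otimes>\<^bsub>A\<^esub> u j \<ominus>\<^bsub>A\<^esub> u j \<otimes>\<^bsub>A\<^esub> u i | i j.
        i \<in> {1..<n} \<and> j \<in> {1..<n} \<and> \<bar>int i - int j\<bar> \<ge> 2} \<union>
     {u i \<otimes>\<^bsub>A\<^esub> u j \<otimes>\<^bsub>A\<^esub> u i \<ominus>\<^bsub>A\<^esub> u i | i j.
        i \<in> {1..<n} \<and> j \<in> {1..<n} \<and> (j = i + 1 \<or> i = j + 1)} \<union>
     {u i \<otimes>\<^bsub>A\<^esub> u i \<ominus>\<^bsub>A\<^esub> free_scalar R a \<otimes>\<^bsub>A\<^esub> u i | i. i \<in> {1..<n}})"

definition TL_ideal :: "('r, 'm) ring_scheme \<Rightarrow> nat \<Rightarrow> 'r \<Rightarrow> (nat list \<Rightarrow> 'r) set"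
  where "TL_ideal R n a = genideal (free_algebra R {1..<n}) (TL_relators R n a)"

definition TL :: "('r, 'm) ring_scheme \<Rightarrow> nat \<Rightarrow> 'r \<Rightarrow> (nat list \<Rightarrow> 'r) set ring"
  where "TL R n a = free_algebra R {1..<n} Quot TL_ideal R n a"

definition TL_class :: "('r, 'm) ring_scheme \<Rightarrow> nat \<Rightarrow> 'r \<Rightarrow> (nat list \<Rightarrow> 'r) \<Rightarrow> (nat list \<Rightarrow> 'r) set"
  where "TL_class R n a f = TL_ideal R n a +>\<^bsub>free_algebra R {1..<n}\<^esub> f"

definition TL_gen :: "('r, 'm) ring_scheme \<Rightarrow> nat \<Rightarrow> 'r \<Rightarrow> nat \<Rightarrow> (nat list \<Rightarrow> 'r) set"
  where "TL_gen R n a i = TL_class R n a (free_gen R i)"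

definition TL_scalar :: "('r, 'm) ring_scheme \<Rightarrow> nat \<Rightarrow> 'r \<Rightarrow> 'r \<Rightarrow> (nat list \<Rightarrow> 'r) set"
  where "TL_scalar R n a r = TL_class R n a (free_scalar R r)"

text \<open>The augmentation sends a class to the constant coefficient of any of its representatives;
  lemma \<open>TL_augmentation\<close> below shows that this is a ring homomorphism which is the identity on
  scalars and annihilates all generators.\<close>

definition TL_augmentation :: "(nat list \<Rightarrow> 'r) set \<Rightarrow> 'r"
  where "TL_augmentation X = the_elem ((\<lambda>f. f []) ` X)"

definition TL_trivial_module :: "('r, 'm) ring_scheme \<Rightarrow> ((nat list \<Rightarrow> 'r) set, 'r) module"
  where "TL_trivial_module R =
    \<lparr>carrier = carrier R, mult = mult R, one = one R, zero = zero R, add = add R,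
     smult = (\<lambda>X r. TL_augmentation X \<otimes>\<^bsub>R\<^esub> r)\<rparr>"


section \<open>The cellular Davis complex\<close>

definition innermost :: "nat \<Rightarrow> nat set \<Rightarrow> bool"
  where "innermost n F \<longleftrightarrow> F \<subseteq> {1..<n} \<and> (\<forall>i\<in>F. \<forall>j\<in>F. i \<noteq> j \<longrightarrow> \<bar>int i - int j\<bar> \<ge> 2)"

text \<open>The generators indexed by an innermost set commute, so the order of the factors is immaterial;
  we take them in increasing order of the index, since \<^const>\<open>finprod\<close> is meant for
  commutative monoids only.\<close>

definition Cup_elem :: "('r, 'm) ring_scheme \<Rightarrow> nat \<Rightarrow> 'r \<Rightarrow> nat set \<Rightarrow> (nat list \<Rightarrow> 'r) set"
  where "Cup_elem R n a F =
    foldr (\<lambda>i x. TL_gen R n a i \<otimes>\<^bsub>TL R n a\<^esub> x) (sorted_list_of_set F) \<one>\<^bsub>TL R n a\<^esub>"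

definition Cup ::
  "('r, 'm) ring_scheme \<Rightarrow> nat \<Rightarrow> 'r \<Rightarrow> nat set \<Rightarrow> ((nat list \<Rightarrow> 'r) set, (nat list \<Rightarrow> 'r) set) module"
  where "Cup R n a F = (regular_module (TL R n a))
    \<lparr>carrier := {x \<otimes>\<^bsub>TL R n a\<^esub> Cup_elem R n a F | x. x \<in> carrier (TL R n a)}\<rparr>"

text \<open>Degrees are integers. No set has negative cardinality, so the complex is the zero module in
  negative degrees and the differential leaving degree 0 is the zero map.\<close>

definition Davis_index :: "nat \<Rightarrow> int \<Rightarrow> nat set set"
  where "Davis_index n \<alpha> = {F. innermost n F \<and> int (card F) = \<alpha>}"

definition Davis ::
  "('r, 'm) ring_scheme \<Rightarrow> nat \<Rightarrow> 'r \<Rightarrow> int \<Rightarrow>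
    ((nat list \<Rightarrow> 'r) set, nat set \<Rightarrow> (nat list \<Rightarrow> 'r) set) module"
  where "Davis R n a \<alpha> = direct_sum_module (Davis_index n \<alpha>) (Cup R n a)"

text \<open>Elements of a direct sum are families \<open>x\<close> with \<open>x F\<close> in the summand of \<open>F\<close>. All summands
  sit inside the algebra, so the inclusion of \<open>Cup(F)\<close> into \<open>Cup(F - {s})\<close> does not change \<open>x F\<close>.\<close>

definition Davis_diff ::
  "('r, 'm) ring_scheme \<Rightarrow> nat \<Rightarrow> 'r \<Rightarrow> int \<Rightarrow>
    (nat set \<Rightarrow> (nat list \<Rightarrow> 'r) set) \<Rightarrow> nat set \<Rightarrow> (nat list \<Rightarrow> 'r) set"
  where "Davis_diff R n a \<alpha> x =
    (\<Oplus>\<^bsub>Davis R n a (\<alpha> - 1)\<^esub>F\<in>Davis_index n \<alpha>. \<Oplus>\<^bsub>Davis R n a (\<alpha> - 1)\<^esub>s\<in>F.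
       add_pow (Davis R n a (\<alpha> - 1)) ((- 1 :: int) ^ card {s'\<in>F. s' < s})
         (direct_sum_inj (Davis_index n (\<alpha> - 1)) (Cup R n a) (F - {s}) (x F)))"


section \<open>Well-definedness\<close>

context cring
begin

lemma conv_Nil:
  assumes "\<And>w. f w \<in> carrier R" "\<And>w. g w \<in> carrier R"
  shows "mult (free_algebra R X) f g [] = f [] \<otimes> g []"
  using assms by (simp add: free_algebra_def)

lemma conv_Cons:
  assumes "\<And>w. f w \<in> carrier R" "\<And>w. g w \<in> carrier R"
  shows "mult (free_algebra R X) f g (x # w) =
    f [] \<otimes> g (x # w) \<oplus> mult (free_algebra R X) (\<lambda>v. f (x # v)) g w"
  using assms by (simp add: free_algebra_def finsum_Suc2 Pi_def a_comm del: finsum_Suc)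

lemma conv_closed:
  assumes "\<And>w. f w \<in> carrier R" "\<And>w. g w \<in> carrier R"
  shows "mult (free_algebra R X) f g w \<in> carrier R"
  using assms by (auto simp: free_algebra_def intro!: finsum_closed)

lemma conv_add_l:
  assumes "\<And>w. f w \<in> carrier R" "\<And>w. g w \<in> carrier R" "\<And>w. h w \<in> carrier R"
  shows "mult (free_algebra R X) (\<lambda>v. f v \<oplus> g v) h w =
    mult (free_algebra R X) f h w \<oplus> mult (free_algebra R X) g h w"
  unfolding free_algebra_def
  by (simp, subst finsum_addf[symmetric]) (use assms in \<open>auto simp: l_distr\<close>)

lemma conv_add_r:
  assumes "\<And>w. f w \<in> carrier R" "\<And>w. g w \<in> carrier R" "\<And>w. h w \<in> carrier R"
  shows "mult (free_algebra R X) h (\<lambda>v. f v \<oplus> g v) w =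
    mult (free_algebra R X) h f w \<oplus> mult (free_algebra R X) h g w"
  unfolding free_algebra_def
  by (simp, subst finsum_addf[symmetric]) (use assms in \<open>auto simp: r_distr\<close>)

lemma conv_scale_l:
  assumes "\<And>w. f w \<in> carrier R" "\<And>w. g w \<in> carrier R" "c \<in> carrier R"
  shows "mult (free_algebra R X) (\<lambda>v. c \<otimes> f v) g w = c \<otimes> mult (free_algebra R X) f g w"
  unfolding free_algebra_def
  by (simp, subst finsum_rdistr) (use assms in \<open>auto simp: m_assoc\<close>)

lemma conv_assoc:
  assumes "\<And>w. f w \<in> carrier R" "\<And>w. g w \<in> carrier R" "\<And>w. h w \<in> carrier R"
  shows "mult (free_algebra R X) (mult (free_algebra R X) f g) h w =
    mult (free_algebra R X) f (mult (free_algebra R X) g h) w"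
  using assms
proof (induction w arbitrary: f g h)
  case Nil
  then show ?case by (simp add: conv_Nil conv_closed m_assoc)
next
  case (Cons x w)
  let ?m = "mult (free_algebra R X)"
  have "?m (?m f g) h (x # w) = ?m f g [] \<otimes> h (x # w) \<oplus> ?m (\<lambda>v. ?m f g (x # v)) h w"
    by (simp add: conv_Cons conv_closed Cons.prems)
  also have "(\<lambda>v. ?m f g (x # v)) = (\<lambda>v. f [] \<otimes> g (x # v) \<oplus> ?m (\<lambda>v. f (x # v)) g v)"
    by (simp add: conv_Cons Cons.prems)
  also have "?m \<dots> h w =
      f [] \<otimes> ?m (\<lambda>v. g (x # v)) h w \<oplus> ?m (\<lambda>v. f (x # v)) (?m g h) w"
    by (simp add: conv_add_l conv_scale_l conv_closed Cons)
  finally show ?case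
    by (simp add: conv_Nil conv_Cons conv_closed Cons.prems r_distr m_assoc a_assoc)
qed

lemma conv_scalar:
  assumes "\<And>w. f w \<in> carrier R" "c \<in> carrier R"
  shows "mult (free_algebra R X) (free_scalar R c) f w = c \<otimes> f w"
proof (cases w)
  case (Cons x v)
  have "mult (free_algebra R X) (\<lambda>v. \<zero>) f v = \<zero>"
    using assms by (simp add: free_algebra_def)
  with Cons show ?thesis using assms by (simp add: conv_Cons free_scalar_def)
qed (use assms in \<open>simp add: conv_Nil free_scalar_def\<close>)

lemma conv_one_r:
  assumes "\<And>w. f w \<in> carrier R"
  shows "mult (free_algebra R X) f (\<lambda>w. if w = [] then \<one> else \<zero>) w = f w"
  using assms
proof (induction w arbitrary: f)
  case Nil
  then show ?case by (subst conv_Nil) auto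
next
  case (Cons x w)
  then show ?case by (subst conv_Cons) auto
qed

lemma conv_nonzero:
  assumes "\<And>w. f w \<in> carrier R" "\<And>w. g w \<in> carrier R"
    and "mult (free_algebra R X) f g w \<noteq> \<zero>"
  shows "\<exists>u v. w = u @ v \<and> f u \<noteq> \<zero> \<and> g v \<noteq> \<zero>"
proof (rule ccontr)
  assume "\<not> ?thesis"
  then have "f (take k w) \<otimes> g (drop k w) = \<zero>" for k
    using assms(1,2) by (metis append_take_drop_id l_null r_null)
  then show False using assms(3) by (simp add: free_algebra_def)
qed

lemma free_algebra_mult_closed:
  assumes "f \<in> carrier (free_algebra R X)" "g \<in> carrier (free_algebra R X)"
  shows "mult (free_algebra R X) f g \<in> carrier (free_algebra R X)"
proof -
  let ?S = "{w. mult (free_algebra R X) f g w \<noteq> \<zero>}"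
  have c: "f w \<in> carrier R" "g w \<in> carrier R" for w
    using assms by (auto simp: free_algebra_def)
  have fin: "finite {w. f w \<noteq> \<zero>}" "finite {w. g w \<noteq> \<zero>}"
    and sub: "{w. f w \<noteq> \<zero>} \<subseteq> lists X" "{w. g w \<noteq> \<zero>} \<subseteq> lists X"
    using assms by (auto simp: free_algebra_def)
  have S: "?S \<subseteq> (\<lambda>(u, v). u @ v) ` ({w. f w \<noteq> \<zero>} \<times> {w. g w \<noteq> \<zero>})"
    using conv_nonzero[OF c] by fastforce
  then have "finite ?S" using fin by (meson finite_SigmaI finite_imageI finite_subset)
  moreover have "?S \<subseteq> lists X" using S sub by fastforce
  moreover have "\<forall>w. mult (free_algebra R X) f g w \<in> carrier R"
    using conv_closed c by blast
  ultimately show ?thesis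
    by (subst free_algebra_def) simp
qed

lemma free_algebra_carrierI:
  assumes "\<And>w. f w \<in> carrier R" "{w. f w \<noteq> \<zero>} \<subseteq> S" "finite S" "S \<subseteq> lists X"
  shows "f \<in> carrier (free_algebra R X)"
proof -
  have "finite {w. f w \<noteq> \<zero>}" using finite_subset assms(2,3) .
  moreover have "{w. f w \<noteq> \<zero>} \<subseteq> lists X" using assms(2,4) by (rule subset_trans)
  ultimately show ?thesis using assms(1) by (simp add: free_algebra_def)
qed

lemma free_algebra_abelian_group: "abelian_group (free_algebra R X)"
proof (rule abelian_groupI)
  fix f assume f: "f \<in> carrier (free_algebra R X)"
  have "(\<lambda>w. \<ominus> f w) \<in> carrier (free_algebra R X)"
    by (rule free_algebra_carrierI[of _ "{w. f w \<noteq> \<zero>}"]) (use f in \<open>auto simp: free_algebra_def\<close>)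
  moreover have "(\<lambda>w. \<ominus> f w) \<oplus>\<^bsub>free_algebra R X\<^esub> f = \<zero>\<^bsub>free_algebra R X\<^esub>"
    using f by (auto simp: free_algebra_def l_neg)
  ultimately show "\<exists>g\<in>carrier (free_algebra R X). g \<oplus>\<^bsub>free_algebra R X\<^esub> f = \<zero>\<^bsub>free_algebra R X\<^esub>"
    by blast
next
  fix f g assume fg: "f \<in> carrier (free_algebra R X)" "g \<in> carrier (free_algebra R X)"
  show "f \<oplus>\<^bsub>free_algebra R X\<^esub> g \<in> carrier (free_algebra R X)"
    by (rule free_algebra_carrierI[of _ "{w. f w \<noteq> \<zero>} \<union> {w. g w \<noteq> \<zero>}"])
      (use fg in \<open>auto simp: free_algebra_def\<close>)
qed (auto simp: free_algebra_def fun_eq_iff a_ac)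

lemma free_algebra_ring: "ring (free_algebra R X)"
proof (rule ringI)
  have c: "f w \<in> carrier R" if "f \<in> carrier (free_algebra R X)" for f w
    using that by (auto simp: free_algebra_def)
  have one: "\<one>\<^bsub>free_algebra R X\<^esub> = free_scalar R \<one>"
    by (auto simp: free_algebra_def free_scalar_def)
  have one': "\<one>\<^bsub>free_algebra R X\<^esub> = (\<lambda>w. if w = [] then \<one> else \<zero>)"
    by (auto simp: free_algebra_def)
  have add: "f \<oplus>\<^bsub>free_algebra R X\<^esub> g = (\<lambda>w. f w \<oplus> g w)" for f g
    by (simp add: free_algebra_def)
  show "monoid (free_algebra R X)"
  proof (rule monoidI)
    show "\<one>\<^bsub>free_algebra R X\<^esub> \<in> carrier (free_algebra R X)"
      by (rule free_algebra_carrierI[of _ "{[]}"]) (auto simp: free_algebra_def)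
  qed (auto simp: free_algebra_mult_closed c conv_assoc fun_eq_iff one' conv_one_r
        conv_scalar[of _ \<one>, unfolded free_scalar_def])
  show "(f \<oplus>\<^bsub>free_algebra R X\<^esub> g) \<otimes>\<^bsub>free_algebra R X\<^esub> h =
      f \<otimes>\<^bsub>free_algebra R X\<^esub> h \<oplus>\<^bsub>free_algebra R X\<^esub> g \<otimes>\<^bsub>free_algebra R X\<^esub> h"
    if "f \<in> carrier (free_algebra R X)" "g \<in> carrier (free_algebra R X)"
      "h \<in> carrier (free_algebra R X)" for f g h
    using that by (auto simp: add conv_add_l c)
  show "h \<otimes>\<^bsub>free_algebra R X\<^esub> (f \<oplus>\<^bsub>free_algebra R X\<^esub> g) =
      h \<otimes>\<^bsub>free_algebra R X\<^esub> f \<oplus>\<^bsub>free_algebra R X\<^esub> h \<otimes>\<^bsub>free_algebra R X\<^esub> g"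
    if "f \<in> carrier (free_algebra R X)" "g \<in> carrier (free_algebra R X)"
      "h \<in> carrier (free_algebra R X)" for f g h
    using that by (auto simp: add conv_add_r c)
qed (rule free_algebra_abelian_group)

lemma free_scalar_closed: "r \<in> carrier R \<Longrightarrow> free_scalar R r \<in> carrier (free_algebra R X)"
  by (rule free_algebra_carrierI[of _ "{[]}"]) (auto simp: free_scalar_def)

lemma free_gen_closed: "i \<in> X \<Longrightarrow> free_gen R i \<in> carrier (free_algebra R X)"
  by (rule free_algebra_carrierI[of _ "{[i]}"]) (auto simp: free_gen_def)

lemma TL_relators_closed:
  assumes "a \<in> carrier R"
  shows "TL_relators R n a \<subseteq> carrier (free_algebra R {1..<n})"
proof -
  interpret A: ring "free_algebra R {1..<n}" by (rule free_algebra_ring)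
  show ?thesis
    using assms unfolding TL_relators_def Let_def
    by (auto simp: free_gen_closed free_scalar_closed simp del: One_nat_def atLeastLessThan_iff)
qed

lemma TL_ideal:
  assumes "a \<in> carrier R"
  shows "ideal (TL_ideal R n a) (free_algebra R {1..<n})"
  unfolding TL_ideal_def
  by (rule ring.genideal_ideal[OF free_algebra_ring TL_relators_closed[OF assms]])

lemma TL_ring:
  assumes "a \<in> carrier R"
  shows "ring (TL R n a)"
  unfolding TL_def by (rule ideal.quotient_is_ring[OF TL_ideal[OF assms]])

lemma constant_coeff_ring_hom: "ring_hom_ring (free_algebra R X) R (\<lambda>f. f [])"
proof (rule ring_hom_ringI[OF free_algebra_ring ring_axioms])
  fix f g assume fg: "f \<in> carrier (free_algebra R X)" "g \<in> carrier (free_algebra R X)"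
  then have "\<And>w. f w \<in> carrier R" "\<And>w. g w \<in> carrier R"
    by (auto simp: free_algebra_def)
  then show "(f \<otimes>\<^bsub>free_algebra R X\<^esub> g) [] = f [] \<otimes> g []"
    by (rule conv_Nil)
qed (auto simp: free_algebra_def)

lemma TL_ideal_constant_coeff:
  assumes "a \<in> carrier R" "f \<in> TL_ideal R n a"
  shows "f [] = \<zero>"
proof -
  let ?A = "free_algebra R {1..<n}"
  define ev where "ev = (\<lambda>f :: nat list \<Rightarrow> 'a. f [])"
  interpret A: ring ?A by (rule free_algebra_ring)
  interpret H: ring_hom_ring ?A R ev unfolding ev_def by (rule constant_coeff_ring_hom)
  have c: "free_scalar R a \<in> carrier ?A" "\<And>i. i \<in> {1..<n} \<Longrightarrow> free_gen R i \<in> carrier ?A"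
    using assms(1) by (auto intro: free_scalar_closed free_gen_closed)
  have g: "ev (free_gen R i) = \<zero>" for i by (simp add: free_gen_def ev_def)
  have "TL_relators R n a \<subseteq> a_kernel ?A R ev"
  proof
    fix f assume f: "f \<in> TL_relators R n a"
    have "ev f = \<zero>"
      using f unfolding TL_relators_def Let_def
      by (auto simp: A.minus_eq c g simp del: One_nat_def atLeastLessThan_iff)
    moreover have "f \<in> carrier ?A" using f TL_relators_closed[OF assms(1)] by blast
    ultimately show "f \<in> a_kernel ?A R ev" unfolding a_kernel_def' by blast
  qed
  then have "TL_ideal R n a \<subseteq> a_kernel ?A R ev"
    unfolding TL_ideal_def by (rule A.genideal_minimal[OF H.kernel_is_ideal])
  with assms(2) have "ev f = \<zero>" unfolding a_kernel_def' by blast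
  then show ?thesis by (simp add: ev_def)
qed

lemma TL_augmentation_class:
  assumes a: "a \<in> carrier R" and f: "f \<in> carrier (free_algebra R {1..<n})"
  shows "TL_augmentation (TL_class R n a f) = f []"
proof -
  interpret I: ideal "TL_ideal R n a" "free_algebra R {1..<n}" by (rule TL_ideal[OF a])
  have "(\<lambda>f. f []) ` TL_class R n a f = {f []}"
  proof -
    have "h [] = f []" if h: "h \<in> TL_class R n a f" for h
    proof -
      obtain g where g: "g \<in> TL_ideal R n a" "h = g \<oplus>\<^bsub>free_algebra R {1..<n}\<^esub> f"
        using h by (auto simp: TL_class_def a_r_coset_def')
      have "h [] = g [] \<oplus> f []" using g by (simp add: free_algebra_def)
      moreover have "f [] \<in> carrier R" using f by (simp add: free_algebra_def)
      ultimately show ?thesis using TL_ideal_constant_coeff[OF a g(1)] by simp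
    qed
    moreover have "f \<in> TL_class R n a f"
      unfolding TL_class_def by (rule I.a_rcos_self[OF f])
    ultimately show ?thesis by blast
  qed
  then show ?thesis by (simp add: TL_augmentation_def)
qed

lemma TL_carrier: "carrier (TL R n a) = TL_class R n a ` carrier (free_algebra R {1..<n})"
  unfolding TL_def FactRing_def A_RCOSETS_def' TL_class_def by (simp add: image_def) blast

lemma TL_augmentation:
  assumes a: "a \<in> carrier R"
  shows "TL_augmentation \<in> ring_hom (TL R n a) R"
    and "\<And>r. r \<in> carrier R \<Longrightarrow> TL_augmentation (TL_scalar R n a r) = r"
    and "\<And>i. i \<in> {1..<n} \<Longrightarrow> TL_augmentation (TL_gen R n a i) = \<zero>"
proof -
  let ?A = "free_algebra R {1..<n}"
  interpret I: ideal "TL_ideal R n a" ?A by (rule TL_ideal[OF a])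
  interpret H: ring_hom_ring ?A R "\<lambda>f. f []" by (rule constant_coeff_ring_hom)
  have m: "TL_class R n a f \<otimes>\<^bsub>TL R n a\<^esub> TL_class R n a g = TL_class R n a (f \<otimes>\<^bsub>?A\<^esub> g)"
    and p: "TL_class R n a f \<oplus>\<^bsub>TL R n a\<^esub> TL_class R n a g = TL_class R n a (f \<oplus>\<^bsub>?A\<^esub> g)"
    if "f \<in> carrier ?A" "g \<in> carrier ?A" for f g
    using that I.rcoset_mult_add I.a_rcos_sum by (simp_all add: TL_def FactRing_def TL_class_def)
  have o: "\<one>\<^bsub>TL R n a\<^esub> = TL_class R n a \<one>\<^bsub>?A\<^esub>"
    by (simp add: TL_def FactRing_def TL_class_def)
  note aug = TL_augmentation_class[OF a]
  show "TL_augmentation \<in> ring_hom (TL R n a) R"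
  proof (rule ring_hom_memI)
    fix x assume "x \<in> carrier (TL R n a)"
    then obtain f where f: "f \<in> carrier ?A" "x = TL_class R n a f"
      unfolding TL_carrier by blast
    then show "TL_augmentation x \<in> carrier R" using H.hom_closed[OF f(1)] by (simp only: aug)
  next
    fix x y assume "x \<in> carrier (TL R n a)" "y \<in> carrier (TL R n a)"
    then obtain f g where f: "f \<in> carrier ?A" "x = TL_class R n a f"
      and g: "g \<in> carrier ?A" "y = TL_class R n a g"
      unfolding TL_carrier by blast
    show "TL_augmentation (x \<otimes>\<^bsub>TL R n a\<^esub> y) = TL_augmentation x \<otimes> TL_augmentation y"
      unfolding f(2) g(2) m[OF f(1) g(1)] aug[OF f(1)] aug[OF g(1)] aug[OF I.m_closed[OF f(1) g(1)]]
      by (rule H.hom_mult[OF f(1) g(1)])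
    show "TL_augmentation (x \<oplus>\<^bsub>TL R n a\<^esub> y) = TL_augmentation x \<oplus> TL_augmentation y"
      unfolding f(2) g(2) p[OF f(1) g(1)] aug[OF f(1)] aug[OF g(1)] aug[OF I.a_closed[OF f(1) g(1)]]
      by (rule H.hom_add[OF f(1) g(1)])
  next
    show "TL_augmentation \<one>\<^bsub>TL R n a\<^esub> = \<one>"
      unfolding o aug[OF I.one_closed] by (rule H.hom_one)
  qed
  show "TL_augmentation (TL_scalar R n a r) = r" if "r \<in> carrier R" for r
    unfolding TL_scalar_def aug[OF free_scalar_closed[OF that]] by (simp add: free_scalar_def)
  show "TL_augmentation (TL_gen R n a i) = \<zero>" if "i \<in> {1..<n}" for i
    unfolding TL_gen_def aug[OF free_gen_closed[OF that]] by (simp add: free_gen_def)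
qed

end

end

theory Submission
  imports Defs
begin

text \<open>Each relation of the Temperley--Lieb algebra identifies two words up to a scalar, so any function
  of words that is constant along the relations grades the algebra as an \<open>R\<close>-module; no basis is
  needed. We grade by the bottom half of the planar diagram of a word, encoded as an involution of the
  points (fixed points are through strands). If a word has a cup at every position of \<open>F\<close>, then
  rewriting it to Jones normal form and commuting letters shows that it lies in \<open>Cup(F)\<close>; hence
  \<open>Cup(F)\<close> is the sum of the graded pieces whose set of cups contains \<open>F\<close>. On the piece with set of
  cups \<open>S\<close> the complex is the augmented simplicial chain complex of the full simplex on \<open>S\<close>, and coning
  off the least cup contracts it unless \<open>S\<close> is empty, which happens only for the scalars.\<close>

section \<open>Words, loops removed\<close>

text \<open>The two inclusions behind the description of Cup(F) are of unequal difficulty. A word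
  ending in the letters of F clearly has cups there; conversely, knowing only the cups of a word,
  one must find an equal word that ends in F. Jones normal form makes this visible: every left end
  of an arc is the last letter of a block, and if i is such a letter while i + 1 is not, then all
  later blocks use letters from i + 2 on, so i slides to the end. The other obstacle is that
  coefficients of words have no meaning in the quotient, and \<open>a\<close> is arbitrary, possibly
  zero or a zero divisor. The remedy is that cutting a coefficient function down to a class of words
  that no relation leaves or enters maps the defining ideal into itself. Multiplication by a word
  shifts such a class, so this has to be proved for all classes at once. Diagrams serve only as an
  invariant: a letter acts on arbitrary involutions of the points, and the relations are checked for
  that action.\<close>

text \<open>The relations of the Temperley--Lieb algebra with scalars forgotten, oriented so that words never
  get longer.\<close>

inductive red :: "nat list \<Rightarrow> nat list \<Rightarrow> bool" where
  red_refl: "red w w"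
| red_trans: "red u v \<Longrightarrow> red v w \<Longrightarrow> red u w"
| red_context: "red u v \<Longrightarrow> red (x @ u @ y) (x @ v @ y)"
| red_comm: "\<bar>int i - int j\<bar> \<ge> 2 \<Longrightarrow> red [i, j] [j, i]"
| red_braid: "j = i + 1 \<or> i = j + 1 \<Longrightarrow> red [i, j, i] [i]"
| red_square: "red [i, i] [i]"

lemma red_append: "red u u' \<Longrightarrow> red v v' \<Longrightarrow> red (u @ v) (u' @ v')"
  using red_context[of u u' "[]" v] red_context[of v v' u' "[]"] by (auto intro: red_trans)

lemma red_set: "red w w' \<Longrightarrow> set w' \<subseteq> set w"
  by (induction rule: red.induct) auto

lemma red_length: "red w w' \<Longrightarrow> length w' \<le> length w"
  by (induction rule: red.induct) auto

lemma red_commute_letter: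
  "(\<And>j. j \<in> set u \<Longrightarrow> \<bar>int i - int j\<bar> \<ge> 2) \<Longrightarrow> red (i # u) (u @ [i])"
proof (induction u)
  case Nil
  show ?case by (simp add: red_refl)
next
  case (Cons j u)
  have "red ([i, j] @ u) ([j, i] @ u)"
    using Cons.prems by (intro red_append red_comm red_refl) auto
  moreover have "red ([j] @ i # u) ([j] @ u @ [i])"
    using Cons by (intro red_append red_refl Cons.IH) auto
  ultimately show ?case by (auto intro: red_trans)
qed

lemma red_commute:
  "(\<And>i j. i \<in> set u \<Longrightarrow> j \<in> set v \<Longrightarrow> \<bar>int i - int j\<bar> \<ge> 2) \<Longrightarrow> red (u @ v) (v @ u)"
proof (induction u)
  case Nil
  show ?case by (simp add: red_refl)
next
  case (Cons i u)
  have "red ([i] @ u @ v) ([i] @ v @ u)"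
    using Cons by (intro red_append red_refl Cons.IH) auto
  moreover have "red ((i # v) @ u) ((v @ [i]) @ u)"
    using Cons.prems by (intro red_append red_refl red_commute_letter) auto
  ultimately show ?case by (auto intro: red_trans)
qed

section \<open>Descending blocks and the Jones normal form\<close>

definition block :: "nat \<Rightarrow> nat \<Rightarrow> nat list"
  where "block d e = rev [e..<Suc d]"

lemma set_block: "set (block d e) = {e..d}"
  by (auto simp: block_def)

lemma length_block: "length (block d e) = Suc d - e"
  by (simp add: block_def del: upt_Suc)

lemma block_snoc: "e \<le> d \<Longrightarrow> block d e = block d (Suc e) @ [e]"
  by (simp add: block_def upt_conv_Cons del: upt_Suc)

lemma block_split: "e \<le> i \<Longrightarrow> i \<le> Suc d \<Longrightarrow> block d e = block d i @ rev [e..<i]"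
  using upt_add_eq_append[of e i "Suc d - i"] by (simp add: block_def del: upt_Suc)

text \<open>The letter \<open>i\<close> moves left past \<open>i - 2\<close>, ..., \<open>e\<close>
  until it meets \<open>i, i - 1\<close>, and \<open>[i, i - 1, i]\<close> collapses; for
  \<open>i = e\<close> it meets its own copy. Either way the extra letter is absorbed, which feeds
  the induction on length in \<open>red_jones\<close>.\<close>

lemma red_block_right:
  assumes "e \<le> i" "i \<le> d"
  shows "\<exists>w. red (block d e @ [i]) w \<and> length w \<le> length (block d e)"
proof (cases "i = e")
  case True
  have "red (block d (Suc e) @ [e, e]) (block d (Suc e) @ [e])"
    by (intro red_append red_refl red_square)
  then show ?thesis using True assms block_snoc[of e d] by (intro exI[of _ "block d e"]) auto
next
  case False
  have s: "block d e = block d (Suc i) @ [i, i - 1] @ rev [e..<i - 1]"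
  proof -
    have "[e..<Suc i] = [e..<i - 1] @ [i - 1, i]"
      using assms False upt_Suc_append[of e "i-1"] by (cases i) auto
    then show ?thesis using assms block_split[of e "Suc i" d] by simp
  qed
  have "red (rev [e..<i - 1] @ [i]) ([i] @ rev [e..<i - 1])"
    by (rule red_commute) auto
  note red_append[OF red_refl red_append[OF red_refl this], of "block d (Suc i)" "[i, i - 1]"]
  moreover have "red (block d (Suc i) @ [i, i - 1, i] @ rev [e..<i - 1])
     (block d (Suc i) @ [i] @ rev [e..<i - 1])"
    using assms False by (intro red_append red_refl red_braid) auto
  ultimately have "red (block d e @ [i]) (block d (Suc i) @ [i] @ rev [e..<i - 1])"
    unfolding s by (simp) (rule red_trans)
  then show ?thesis unfolding s by (intro exI conjI) auto
qed

text \<open>From the other side: \<open>i\<close> moves right past \<open>d\<close>, ...,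
  \<open>i + 2\<close>, and \<open>[i, i + 1, i]\<close> collapses.\<close>

lemma red_block_left:
  assumes "e \<le> i" "i < d"
  shows "\<exists>w. red (i # block d e) w \<and> length w \<le> length (block d e)"
proof -
  have s: "block d e = block d (i + 2) @ [i + 1, i] @ rev [e..<i]"
  proof -
    have "[e..<i + 2] = [e..<i] @ [i, i + 1]"
      using assms by auto
    then show ?thesis using assms block_split[of e "i + 2" d] by simp
  qed
  have "red ([i] @ block d (i + 2)) (block d (i + 2) @ [i])"
    by (rule red_commute) (auto simp: set_block)
  note red_append[OF this red_refl, of "[i + 1, i] @ rev [e..<i]"]
  moreover have "red (block d (i + 2) @ [i, i + 1, i] @ rev [e..<i])
      (block d (i + 2) @ [i] @ rev [e..<i])"
    by (intro red_append red_refl red_braid) auto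
  ultimately have "red (i # block d e) (block d (i + 2) @ [i] @ rev [e..<i])"
    unfolding s by simp (rule red_trans)
  then show ?thesis unfolding s by (intro exI conjI) auto
qed

text \<open>Jones normal forms: products of descending blocks \<open>d, d - 1, \<dots>, e\<close> whose starts \<open>d\<close> and ends \<open>e\<close> both
  strictly increase. The set \<open>E\<close> collects the ends, and \<open>m\<close> is a strict upper bound for the letters.\<close>

inductive jones :: "nat \<Rightarrow> nat set \<Rightarrow> nat list \<Rightarrow> bool" where
  jones_Nil: "jones m {} []"
| jones_block: "jones d E u \<Longrightarrow> (\<And>x. x \<in> E \<Longrightarrow> x < e) \<Longrightarrow> e \<le> d \<Longrightarrow> d < m \<Longrightarrow>
    jones m (insert e E) (u @ block d e)"

lemma jones_set: "jones m E w \<Longrightarrow> set w \<subseteq> {..<m}"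
  by (induction rule: jones.induct) (auto simp: set_block)

lemma jones_ends: "jones m E w \<Longrightarrow> E \<subseteq> set w"
  by (induction rule: jones.induct) (auto simp: set_block)

lemma jones_last:
  "jones m E w \<Longrightarrow> E \<noteq> {} \<Longrightarrow> \<exists>u i. w = u @ [i] \<and> i \<in> E \<and> (\<forall>x\<in>E. x \<le> i)"
proof (induction rule: jones.induct)
  case (jones_block d E u e m)
  then show ?case
    by (intro exI[of _ "u @ block d (Suc e)"] exI[of _ e]) (auto simp: block_snoc[of e d] less_imp_le)
qed simp

text \<open>Take a prefix in normal form with last block \<open>d\<close>, ..., \<open>e\<close> and
  look at the final letter \<open>i\<close>. If \<open>d < i\<close>, it opens a new block; if
  \<open>e \<le> i \<le> d\<close>, the block absorbs it; if \<open>e = Suc i\<close>, it extends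
  the block; otherwise it moves left past the block and the part in front is normalised again. In
  the last two cases an earlier end may fail to lie below the new last end; \<open>collide\<close>
  then produces a shorter word.\<close>

lemma red_jones:
  "set w \<subseteq> {..<m} \<Longrightarrow> \<exists>w' E. red w w' \<and> jones m E w'"
proof (induction "length w" arbitrary: w m rule: less_induct)
  case less
  have shorter: ?case if a: "red w v" "length v < length w" for v
  proof -
    have "set v \<subseteq> {..<m}" using red_set[OF a(1)] less.prems by blast
    from less.hyps[OF a(2) this] show ?thesis using a(1) by (blast intro: red_trans)
  qed
  \<comment> \<open>An end that is too large meets the next block, which then absorbs a letter.\<close>
  have collide: ?case
    if a: "red w (u @ block d e)" "jones m' E u" "x \<in> E" "e \<le> x" "m' \<le> d"
      "length (u @ block d e) \<le> length w" for u d e m' E x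
  proof -
    obtain u' i where u: "u = u' @ [i]" "i \<in> E" "x \<le> i"
      using jones_last[OF a(2)] a(3) by blast
    have "i < d" using u jones_set[OF a(2)] a(5) by auto
    then obtain v where v: "red (i # block d e) v" "length v \<le> length (block d e)"
      using red_block_left[of e i d] a(4) u by auto
    have "red (u' @ i # block d e) (u' @ v)" by (intro red_append red_refl v)
    then have "red w (u' @ v)" using a(1) u by (auto intro: red_trans)
    then show ?thesis using shorter[of "u' @ v"] v a(6) u by auto
  qed
  show ?case
  proof (cases w rule: rev_cases)
    case Nil
    then show ?thesis using jones_Nil red_refl by blast
  next
    case (snoc v i)
    have im: "i < m" using less.prems snoc by auto
    obtain v' E where v': "red v v'" "jones m E v'"
      using less.hyps[of v m] less.prems snoc by auto
    have w1: "red w (v' @ [i])" using v'(1) snoc by (auto intro: red_append red_refl)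
    have l1: "length v' \<le> length v" by (rule red_length[OF v'(1)])
    from v'(2) show ?thesis
    proof (cases rule: jones.cases)
      case jones_Nil
      have "jones m (insert i {}) ([] @ block i i)"
        using im by (intro jones.jones_block[OF jones.jones_Nil]) auto
      then show ?thesis using w1 jones_Nil by (auto simp: block_def)
    next
      case (jones_block d E0 u e)
      have l2: "length u + (Suc d - e) \<le> length v"
        using l1 jones_block by (simp add: length_block)
      have w2: "red w (u @ block d e @ [i])" using w1 jones_block by simp
      consider "d < i" | "e \<le> i" "i \<le> d" | "e = Suc i" | "i + 2 \<le> e" by linarith
      then show ?thesis
      proof cases
        case 1
        have "x < i" if "x \<in> E" for x using that 1 jones_block(1,4,5,6) by force
        \<comment> \<open>The bound may be tightened to \<open>i\<close> because the last block
          starts at \<open>d < i\<close>.\<close>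
        moreover have "jones i E v'" unfolding jones_block using jones_block 1 by (auto intro: jones.intros)
        ultimately have "jones m (insert i E) (v' @ block i i)"
          using im by (intro jones.intros) auto
        then show ?thesis using w1 by (auto simp: block_def)
      next
        case 2
        then obtain z where z: "red (block d e @ [i]) z" "length z \<le> length (block d e)"
          using red_block_right by blast
        have "red (u @ block d e @ [i]) (u @ z)" by (intro red_append red_refl z)
        then show ?thesis using shorter[of "u @ z"] w2 z l2 snoc
          by (auto simp: length_block intro: red_trans)
      next
        case 3
        have w3: "red w (u @ block d i)" using w2 3 jones_block block_snoc[of i d] by simp
        show ?thesis
        proof (cases "\<forall>x\<in>E0. x < i")
          case True
          then have "jones m (insert i E0) (u @ block d i)"
            using jones_block 3 by (intro jones.intros) auto
          then show ?thesis using w3 by blast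
        next
          case False
          then obtain x where "x \<in> E0" "i \<le> x" by auto
          then show ?thesis using collide[OF w3] jones_block l2 snoc 3
            by (auto simp: length_block)
        qed
      next
        case 4
        have "red (block d e @ [i]) ([i] @ block d e)"
          by (rule red_commute) (use 4 in \<open>auto simp: set_block\<close>)
        from red_append[OF red_refl this, of u]
        have w3: "red w ((u @ [i]) @ block d e)" using w2 by (auto intro: red_trans)
        have "length (u @ [i]) < length w" using l2 snoc jones_block by simp
        \<comment> \<open>The induction hypothesis gets the bound \<open>d\<close> instead of
          \<open>m\<close>, so that the new prefix can again precede a block starting at
          \<open>d\<close>.\<close>
        moreover have "set (u @ [i]) \<subseteq> {..<d}"
          using jones_set[OF \<open>jones d E0 u\<close>] 4 jones_block by auto
        ultimately obtain u' E' where u': "red (u @ [i]) u'" "jones d E' u'"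
          using less.hyps by blast
        have w4: "red w (u' @ block d e)"
          using w3 red_append[OF u'(1) red_refl] by (rule red_trans)
        show ?thesis
        proof (cases "\<forall>x\<in>E'. x < e")
          case True
          then have "jones m (insert e E') (u' @ block d e)"
            using jones_block u' by (intro jones.intros) auto
          then show ?thesis using w4 by blast
        next
          case False
          then obtain x where "x \<in> E'" "e \<le> x" by auto
          then show ?thesis using collide[OF w4 u'(2)] red_length[OF u'(1)] l2 snoc
            by (auto simp: length_block)
        qed
      qed
    qed
  qed
qed

text \<open>If i is an end and i + 1 is not, all letters of later blocks are at least i + 2, because
  the ends increase. So i, the last letter of its block, commutes with everything behind it.
  Extracting the ends in the order of the blocks keeps the list sorted.\<close>

lemma red_extract:
  assumes "jones m E w" "F \<subseteq> {i\<in>E. Suc i \<notin> E}"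
  shows "\<exists>u. red w (u @ sorted_list_of_set F)"
  using assms
proof (induction arbitrary: F rule: jones.induct)
  case (jones_Nil m)
  then show ?case using red_refl by auto
next
  case (jones_block d E u e m)
  define F0 where "F0 = F - {e}"
  have F0: "i \<in> E" "Suc i \<notin> E" "i + 2 \<le> e" if "i \<in> F0" for i
    using that jones_block.prems jones_block.hyps(2)[of i] unfolding F0_def
    by (auto simp: le_less Suc_le_eq)
  have finF0: "finite F0"
    using F0(3) by (intro finite_subset[of F0 "{..e}"]) fastforce+
  obtain u' where u': "red u (u' @ sorted_list_of_set F0)"
    using jones_block.IH[of F0] F0 by auto
  \<comment> \<open>Used for \<open>k = e\<close>, when the extracted letters pass the whole block,
    and for \<open>k = Suc e\<close>, when the last letter \<open>e\<close> is itself extracted and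
    stays behind them.\<close>
  have c: "red (u' @ sorted_list_of_set F0 @ block d k) (u' @ block d k @ sorted_list_of_set F0)"
    if "e \<le> k" for k
    using F0(3) that finF0 by (intro red_append red_refl red_commute) (force simp: set_block)
  show ?case
  proof (cases "e \<in> F")
    case False
    then have "F0 = F" by (auto simp: F0_def)
    then have "red (u @ block d e) ((u' @ block d e) @ sorted_list_of_set F)"
      using red_append[OF u' red_refl, of "block d e"] c[of e] by (auto intro: red_trans)
    then show ?thesis by blast
  next
    case True
    have "sorted_list_of_set F0 @ [e] = sorted_list_of_set F"
      using True finF0 F0(3) unfolding F0_def
      by (intro sorted_list_of_set.idem_if_sorted_distinct[symmetric, THEN trans, OF _ _ arg_cong[of _ _ sorted_list_of_set]])
        (force simp: sorted_append)+
    moreover have "red (u @ block d (Suc e) @ [e]) (u' @ block d (Suc e) @ sorted_list_of_set F0 @ [e])"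
      using red_append[OF u' red_refl, of "block d (Suc e) @ [e]"]
        red_append[OF c[of "Suc e"] red_refl, of "[e]"] by (auto intro: red_trans)
    ultimately have "red (u @ block d e) ((u' @ block d (Suc e)) @ sorted_list_of_set F)"
      using jones_block.hyps by (simp add: block_snoc[of e d])
    then show ?thesis by blast
  qed
qed

section \<open>Half diagrams\<close>

definition involution :: "('a \<Rightarrow> 'a) \<Rightarrow> bool"
  where "involution f \<longleftrightarrow> (\<forall>x. f (f x) = x)"

text \<open>The effect of appending a cap and a cup at points \<open>p\<close> and \<open>q\<close> to a half diagram: the partners of \<open>p\<close>
  and \<open>q\<close> get connected, a partner of a through strand becomes a through strand, and closed loops
  disappear.\<close>

definition cup_cap :: "'a \<Rightarrow> 'a \<Rightarrow> ('a \<Rightarrow> 'a) \<Rightarrow> 'a \<Rightarrow> 'a"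
  where "cup_cap p q f x =
    (if x = p then q else if x = q then p
     else if f x = p then (if f q = q then x else f q)
     else if f x = q then (if f p = p then x else f p) else f x)"

lemma involution_cup_cap:
  assumes "involution f"
  shows "involution (cup_cap p q f)"
  unfolding involution_def
proof
  fix x
  have "f (f p) = p" "f (f q) = q" "f (f x) = x"
    using assms unfolding involution_def by auto
  then show "cup_cap p q f (cup_cap p q f x) = x"
    unfolding cup_cap_def by (smt (verit))
qed

lemma cup_cap_square:
  assumes "involution f"
  shows "cup_cap p q (cup_cap p q f) = cup_cap p q f"
proof
  fix x
  have "f (f p) = p" "f (f q) = q" "f (f x) = x"
    using assms unfolding involution_def by auto
  then show "cup_cap p q (cup_cap p q f) x = cup_cap p q f x"
    unfolding cup_cap_def by (smt (verit))
qed

lemma cup_cap_commute: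
  assumes "involution f" "p \<noteq> q" "r \<noteq> s" "p \<noteq> r" "p \<noteq> s" "q \<noteq> r" "q \<noteq> s"
  shows "cup_cap p q (cup_cap r s f) = cup_cap r s (cup_cap p q f)"
proof
  fix x
  have "f (f p) = p" "f (f q) = q" "f (f r) = r" "f (f s) = s" "f (f x) = x"
    using assms(1) unfolding involution_def by auto
  then show "cup_cap p q (cup_cap r s f) x = cup_cap r s (cup_cap p q f) x"
    unfolding cup_cap_def using assms(2-) by (smt (verit))
qed

lemma cup_cap_braid:
  assumes "involution f" "p \<noteq> q" "q \<noteq> r" "p \<noteq> r"
  shows "cup_cap p q (cup_cap q r (cup_cap p q f)) = cup_cap p q f"
    and "cup_cap q r (cup_cap p q (cup_cap q r f)) = cup_cap q r f"
proof -
  have f: "f (f p) = p" "f (f q) = q" "f (f r) = r" "f (f x) = x" for x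
    using assms(1) unfolding involution_def by auto
  show "cup_cap p q (cup_cap q r (cup_cap p q f)) = cup_cap p q f"
  proof
    fix x
    show "cup_cap p q (cup_cap q r (cup_cap p q f)) x = cup_cap p q f x"
      unfolding cup_cap_def using f(1-3) f(4)[of x] assms(2-) by (smt (verit))
  qed
  show "cup_cap q r (cup_cap p q (cup_cap q r f)) = cup_cap q r f"
  proof
    fix x
    show "cup_cap q r (cup_cap p q (cup_cap q r f)) x = cup_cap q r f x"
      unfolding cup_cap_def using f(1-3) f(4)[of x] assms(2-) by (smt (verit))
  qed
qed

text \<open>The fold starts at \<open>id\<close>, where every strand is a through strand. The last
  letter acts last and so sits at the bottom, the side on which Cup(F) prescribes its cups.\<close>

definition half_diagram :: "nat list \<Rightarrow> nat \<Rightarrow> nat"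
  where "half_diagram w = fold (\<lambda>i. cup_cap i (Suc i)) w id"

lemma involution_fold: "involution f \<Longrightarrow> involution (fold (\<lambda>i. cup_cap i (Suc i)) w f)"
  by (induction w arbitrary: f) (auto intro: involution_cup_cap)

lemma involution_half_diagram: "involution (half_diagram w)"
  unfolding half_diagram_def by (rule involution_fold) (simp add: involution_def)

text \<open>The starting involution is arbitrary because in the context rule the letters in front
  have already changed the diagram.\<close>

lemma red_fold:
  "red u v \<Longrightarrow> involution f \<Longrightarrow>
    fold (\<lambda>i. cup_cap i (Suc i)) u f = fold (\<lambda>i. cup_cap i (Suc i)) v f"
proof (induction arbitrary: f rule: red.induct)
  case (red_comm i j)
  then show ?case using cup_cap_commute[of f j "Suc j" i "Suc i"] by auto
next
  case (red_braid j i)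
  then show ?case
    using cup_cap_braid[of f i "Suc i" "Suc j"] cup_cap_braid[of f j "Suc j" "Suc i"] by auto
qed (simp_all add: involution_fold cup_cap_square)

lemma red_half_diagram: "red u v \<Longrightarrow> half_diagram u = half_diagram v"
  unfolding half_diagram_def by (rule red_fold) (simp_all add: involution_def)

lemma half_diagram_snoc: "half_diagram (w @ [i]) = cup_cap i (Suc i) (half_diagram w)"
  by (simp add: half_diagram_def)

lemma half_diagram_fix: "(\<And>i. i \<in> set w \<Longrightarrow> Suc i < x) \<Longrightarrow> half_diagram w x = x"
proof (induction w rule: rev_induct)
  case (snoc i w)
  then have "half_diagram w x = x" "x \<noteq> i" "x \<noteq> Suc i" by force+
  then show ?case by (auto simp: half_diagram_snoc cup_cap_def)
qed (simp add: half_diagram_def)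

text \<open>The points \<open>x\<close> with \<open>x < f x\<close> are the left ends of the arcs of \<open>f\<close>.\<close>

lemma cup_cap_opener:
  assumes "involution f" "f j \<le> j" "Suc j \<le> f (Suc j)"
  shows "cup_cap j (Suc j) f x > x \<Longrightarrow> x = j \<or> (x \<noteq> Suc j \<and> f x > x)"
    and "cup_cap j (Suc j) f x = Suc x \<Longrightarrow> Suc x < j \<Longrightarrow> f x = Suc x"
proof -
  have "f (f x) = x" using assms(1) by (simp add: involution_def)
  then show "cup_cap j (Suc j) f x > x \<Longrightarrow> x = j \<or> (x \<noteq> Suc j \<and> f x > x)"
    and "cup_cap j (Suc j) f x = Suc x \<Longrightarrow> Suc x < j \<Longrightarrow> f x = Suc x"
    using assms(2,3) by (auto simp: cup_cap_def split: if_splits)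
qed

text \<open>As the letters \<open>d\<close>, ..., \<open>e\<close> are appended, one left end walks
  down from \<open>d\<close> to \<open>e\<close>. At each letter \<open>k\<close> the partners of
  \<open>k\<close> and \<open>k + 1\<close> get connected, but the first lies weakly left of
  \<open>k\<close> and the second weakly right of \<open>k + 1\<close>, so the left end of the
  connected arc was a left end before, and this arc cannot be a cup below \<open>k\<close>.\<close>

lemma half_diagram_block:
  assumes f: "half_diagram u (Suc d) = Suc d" "\<And>x. x < half_diagram u x \<Longrightarrow> x < e" and "e \<le> d"
  shows "half_diagram (u @ block d e) e = Suc e"
    and "x < half_diagram (u @ block d e) x \<Longrightarrow> x = e \<or> (x < e \<and> x < half_diagram u x)"
    and "half_diagram (u @ block d e) x = Suc x \<Longrightarrow> Suc x < e \<Longrightarrow> half_diagram u x = Suc x"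
proof -
  define P where "P k \<longleftrightarrow> (let g = half_diagram (u @ block d k) in g k = Suc k \<and>
    (\<forall>x. x < g x \<longrightarrow> x = k \<or> (x < e \<and> x < half_diagram u x)) \<and>
    (\<forall>x. g x = Suc x \<longrightarrow> Suc x < e \<longrightarrow> half_diagram u x = Suc x))" for k
  \<comment> \<open>Here \<open>g\<close> is the half diagram just before the letter
    \<open>k\<close>. At first \<open>k = d\<close> and \<open>d + 1\<close> is a through strand;
    later the preceding letter joins \<open>k + 1\<close> to \<open>k + 2\<close>. Hence
    \<open>k + 1\<close> is never a right end, and \<open>k\<close> is never a left end.\<close>
  have extend: "P k" if k: "half_diagram (u @ block d k) = cup_cap k (Suc k) g" "e \<le> k"
     "involution g" "g k \<le> k" "Suc k \<le> g (Suc k)"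
     "\<And>x. x < g x \<Longrightarrow> x = Suc k \<or> (x < e \<and> x < half_diagram u x)"
     "\<And>x. g x = Suc x \<Longrightarrow> Suc x < e \<Longrightarrow> half_diagram u x = Suc x" for k g
    unfolding P_def Let_def k(1)
    using cup_cap_opener[OF k(3-5)] k(2,6,7) by (fastforce simp: cup_cap_def[of _ _ _ k])
  have "P e"
    using \<open>e \<le> d\<close>
  proof (induction rule: inc_induct)
    case base
    have "half_diagram u d \<le> d" using f(2)[of d] \<open>e \<le> d\<close> by force
    then show ?case
      using f \<open>e \<le> d\<close>
      by (intro extend[OF _ _ involution_half_diagram, of d u]) (auto simp: block_def half_diagram_snoc)
  next
    case (step k)
    define g where "g = half_diagram (u @ block d (Suc k))"
    have g: "g (Suc k) = Suc (Suc k)" "x < g x \<Longrightarrow> x = Suc k \<or> (x < e \<and> x < half_diagram u x)"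
       "g x = Suc x \<Longrightarrow> Suc x < e \<Longrightarrow> half_diagram u x = Suc x" for x
      using step.IH unfolding P_def Let_def g_def by auto
    have "half_diagram (u @ block d k) = cup_cap k (Suc k) g"
      using step.hyps block_snoc[of k d] half_diagram_snoc[of "u @ block d (Suc k)" k]
      by (simp add: g_def)
    moreover have "g k \<le> k" using g(2)[of k] step.hyps by force
    ultimately show ?case
      using step.hyps g by (intro extend[of k g]) (auto simp: g_def involution_half_diagram)
  qed
  then show "half_diagram (u @ block d e) e = Suc e"
    and "x < half_diagram (u @ block d e) x \<Longrightarrow> x = e \<or> (x < e \<and> x < half_diagram u x)"
    and "half_diagram (u @ block d e) x = Suc x \<Longrightarrow> Suc x < e \<Longrightarrow> half_diagram u x = Suc x"
    unfolding P_def Let_def by blast+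
qed

text \<open>A block adds at most its own end to the left ends of arcs. For a cup x below the last
  end e, x + 1 = e is impossible because e is joined to e + 1; so the cup comes from the earlier
  blocks. Together the two parts put the cups of w inside
  \<open>{i\<in>E. Suc i \<notin> E}\<close>, the set that \<open>red_extract\<close> can
  handle.\<close>

lemma jones_half_diagram:
  assumes "jones m E w"
  shows "x < half_diagram w x \<Longrightarrow> x \<in> E"
    and "half_diagram w x = Suc x \<Longrightarrow> Suc x \<notin> E"
  using assms
proof (induction arbitrary: x rule: jones.induct)
  case (jones_Nil m)
  { case 1 then show ?case by (simp add: half_diagram_def) }
  { case 2 then show ?case by simp }
next
  case (jones_block d E u e m)
  have fix1: "half_diagram u (Suc d) = Suc d"
    using jones_set[OF jones_block.hyps(1)] by (intro half_diagram_fix) auto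
  have o: "x < e" if "x < half_diagram u x" for x
    using jones_block.IH(1) jones_block.hyps(2) that by blast
  note b = half_diagram_block[OF fix1 o jones_block.hyps(3)]
  { case 1 then show ?case using b(2) jones_block.IH(1) by blast }
  { case 2
    then have x: "x = e \<or> (x < e \<and> x < half_diagram u x)" using b(2) by simp
    show ?case
    proof (cases "x = e")
      case True
      then show ?thesis using jones_block.hyps(2) by fastforce
    next
      case False
      have "Suc x \<noteq> e"
      proof
        assume "Suc x = e"
        moreover have "half_diagram (u @ block d e) (half_diagram (u @ block d e) x) = x"
          using involution_half_diagram unfolding involution_def by blast
        ultimately show False using 2 b(1) by simp
      qed
      then have "Suc x < e" using x False by auto
      then show ?thesis using b(3) 2 jones_block.IH(2) by fastforce
    qed }
qed

section \<open>The set of cups of a word\<close>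

definition cups :: "nat list \<Rightarrow> nat set"
  where "cups w = {i. half_diagram w i = Suc i}"

lemma red_cups: "red u v \<Longrightarrow> cups u = cups v"
  by (simp add: cups_def red_half_diagram)

lemma cups_Nil: "cups [] = {}"
  by (simp add: cups_def half_diagram_def)

lemma cups_snoc: "i \<in> cups (w @ [i])"
  by (simp add: cups_def half_diagram_snoc cup_cap_def)

lemma red_ends_with_cups:
  assumes "F \<subseteq> cups w"
  shows "\<exists>u. red w (u @ sorted_list_of_set F)"
proof -
  obtain m where "set w \<subseteq> {..<m}"
    using finite_nat_set_iff_bounded[of "set w"] by auto
  then obtain w' E where w': "red w w'" "jones m E w'"
    using red_jones by blast
  have "F \<subseteq> {i\<in>E. Suc i \<notin> E}"
    using assms jones_half_diagram[OF w'(2)] by (auto simp: cups_def red_half_diagram[OF w'(1)])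
  then show ?thesis using red_extract[OF w'(2)] w'(1) by (blast intro: red_trans)
qed

text \<open>A cup can appear when a different letter is appended: after \<open>[2, 1, 3, 2]\<close>
  the letter 3 creates a cup at 1. The argument therefore goes through the normal form, whose cups
  are block ends, and \<open>red\<close> introduces no new letters.\<close>

lemma cups_subset_set: "cups w \<subseteq> set w"
proof -
  obtain m where "set w \<subseteq> {..<m}"
    using finite_nat_set_iff_bounded[of "set w"] by auto
  then obtain w' E where w': "red w w'" "jones m E w'"
    using red_jones by blast
  have "cups w \<subseteq> E"
    using jones_half_diagram[OF w'(2)] by (auto simp: cups_def red_half_diagram[OF w'(1)])
  then show ?thesis using jones_ends[OF w'(2)] red_set[OF w'(1)] by blast
qed

lemma innermost_cups:
  assumes "set w \<subseteq> {1..<n}"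
  shows "innermost n (cups w)"
proof -
  have disj: "Suc i \<notin> cups w" if "i \<in> cups w" for i
  proof -
    have "half_diagram w (half_diagram w i) = i"
      using involution_half_diagram[of w] unfolding involution_def by blast
    then show ?thesis using that by (simp add: cups_def)
  qed
  have "\<bar>int i - int j\<bar> \<ge> 2" if "i \<in> cups w" "j \<in> cups w" "i \<noteq> j" for i j
  proof -
    have "j \<noteq> Suc i" "i \<noteq> Suc j" using that disj by auto
    then show ?thesis using that(3) by linarith
  qed
  then show ?thesis using assms cups_subset_set[of w] unfolding innermost_def by blast
qed

lemma innermost_subset: "innermost n F \<Longrightarrow> G \<subseteq> F \<Longrightarrow> innermost n G"
  by (auto simp: innermost_def)

lemma finite_innermost: "innermost n F \<Longrightarrow> finite F"
  unfolding innermost_def using finite_subset by blast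

text \<open>Each letter of F can be commuted into the last position, where it makes a cup.\<close>

lemma cups_append_innermost:
  "innermost n F \<Longrightarrow> i \<in> F \<Longrightarrow> i \<in> cups (w @ sorted_list_of_set F)"
proof -
  assume F: "innermost n F" "i \<in> F"
  define G where "G = sorted_list_of_set F"
  have G: "i \<in> set G" "\<And>j k. j \<in> set G \<Longrightarrow> k \<in> set G \<Longrightarrow> j \<noteq> k \<Longrightarrow> \<bar>int j - int k\<bar> \<ge> 2" "distinct G"
    using F finite_innermost[OF F(1)] by (auto simp: G_def innermost_def)
  then obtain xs ys where s: "G = xs @ i # ys" by (meson split_list)
  have "red (i # ys) (ys @ [i])" 
    using G unfolding s by (intro red_commute_letter) auto
  then have "red ((w @ xs) @ i # ys) ((w @ xs) @ ys @ [i])" by (intro red_append red_refl)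
  then show ?thesis using red_cups cups_snoc[of i "w @ xs @ ys"] unfolding G_def[symmetric] s by auto
qed

section \<open>Sums and modules\<close>

lemma (in abelian_group_hom) hom_finsum:
  assumes "g \<in> S \<rightarrow> carrier G"
  shows "h (finsum G g S) = (\<Oplus>\<^bsub>H\<^esub>i\<in>S. h (g i))"
  using assms
proof (induction S rule: infinite_finite_induct)
  case (insert i S)
  then have "g i \<in> carrier G" "g \<in> S \<rightarrow> carrier G" by auto
  moreover from this have "h (g i) \<in> carrier H" "(\<lambda>i. h (g i)) \<in> S \<rightarrow> carrier H"
    by (auto simp: Pi_iff)
  ultimately show ?case using insert by (simp add: G.finsum_insert H.finsum_insert)
qed (simp_all add: G.finsum_infinite H.finsum_infinite)

lemma (in abelian_group) add_pow_sign:
  assumes "x \<in> carrier G"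
  shows "add_pow G ((- 1 :: int) ^ k) x = (if even k then x else \<ominus> x)"
proof (cases "even k")
  case True
  then show ?thesis using assms add_pow_int_ge[of 1 G x] by (simp add: add_pow_def nat_pow_def)
next
  case False
  then show ?thesis using assms add_pow_int_lt[of "- 1" G x] by (simp add: add_pow_def nat_pow_def)
qed

lemma (in abelian_group) finsum_neg:
  "f \<in> S \<rightarrow> carrier G \<Longrightarrow> (\<Oplus>i\<in>S. \<ominus> f i) = \<ominus> (\<Oplus>i\<in>S. f i)"
proof (induction S rule: infinite_finite_induct)
  have zero: "\<ominus> \<zero> = \<zero>" using l_neg[of \<zero>] r_zero[of "\<ominus> \<zero>"] by auto
  { case (infinite S) then show ?case by (simp add: zero) }
  { case empty then show ?case by (simp add: zero) }
next
  case (insert i S)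
  then have "f i \<in> carrier G" "f \<in> S \<rightarrow> carrier G" "(\<lambda>i. \<ominus> f i) \<in> S \<rightarrow> carrier G" by auto
  then show ?case using insert by (simp add: finsum_insert finsum_closed minus_add)
qed

text \<open>Peeling off one index cancels its row against its column, term by term. The diagonal
  needs its own hypothesis, since being its own negative does not force an element to be
  zero.\<close>

lemma (in abelian_group) finsum_alternating:
  assumes "finite S" "\<And>s t. s \<in> S \<Longrightarrow> t \<in> S \<Longrightarrow> b s t \<in> carrier G"
    and "\<And>s. s \<in> S \<Longrightarrow> b s s = \<zero>" "\<And>s t. s \<in> S \<Longrightarrow> t \<in> S \<Longrightarrow> s \<noteq> t \<Longrightarrow> b s t = \<ominus> b t s"
  shows "(\<Oplus>s\<in>S. \<Oplus>t\<in>S. b s t) = \<zero>"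
  using assms
proof (induction S)
  case (insert k S)
  have closed: "b s t \<in> carrier G" if "s \<in> insert k S" "t \<in> insert k S" for s t
    using insert.prems(1) that by blast
  have c: "b k k \<in> carrier G" "b k \<in> S \<rightarrow> carrier G" "(\<lambda>s. b s k) \<in> S \<rightarrow> carrier G"
    "\<And>s. s \<in> S \<Longrightarrow> b s \<in> S \<rightarrow> carrier G"
    using closed by auto
  have neg: "(\<Oplus>s\<in>S. b s k) = \<ominus> (\<Oplus>s\<in>S. b k s)"
  proof -
    have "(\<Oplus>s\<in>S. b s k) = (\<Oplus>s\<in>S. \<ominus> b k s)"
    proof (rule finsum_cong')
      show "b s k = \<ominus> b k s" if "s \<in> S" for s
        using insert.prems(3)[of s k] insert.hyps that by blast
    qed (use c in auto)
    then show ?thesis using finsum_neg[OF c(2)] by simp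
  qed
  have "(\<Oplus>s\<in>insert k S. \<Oplus>t\<in>insert k S. b s t) =
     (b k k \<oplus> (\<Oplus>t\<in>S. b k t)) \<oplus> (\<Oplus>s\<in>S. b s k \<oplus> (\<Oplus>t\<in>S. b s t))"
  proof -
    have "(\<Oplus>t\<in>insert k S. b s t) = b s k \<oplus> (\<Oplus>t\<in>S. b s t)" if "s \<in> insert k S" for s
      using closed insert.hyps that by (intro finsum_insert) auto
    then have "(\<Oplus>s\<in>insert k S. \<Oplus>t\<in>insert k S. b s t) = (\<Oplus>s\<in>insert k S. b s k \<oplus> (\<Oplus>t\<in>S. b s t))"
      using closed by (intro finsum_cong') (auto intro!: finsum_closed)
    also have "\<dots> = (b k k \<oplus> (\<Oplus>t\<in>S. b k t)) \<oplus> (\<Oplus>s\<in>S. b s k \<oplus> (\<Oplus>t\<in>S. b s t))"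
      using closed insert.hyps by (intro finsum_insert) (auto intro!: finsum_closed)
    finally show ?thesis .
  qed
  also have "(\<Oplus>s\<in>S. b s k \<oplus> (\<Oplus>t\<in>S. b s t)) = (\<Oplus>s\<in>S. b s k) \<oplus> (\<Oplus>s\<in>S. \<Oplus>t\<in>S. b s t)"
    using c by (intro finsum_addf) (auto intro!: finsum_closed)
  also have "(\<Oplus>s\<in>S. \<Oplus>t\<in>S. b s t) = \<zero>"
    by (rule insert.IH) (use closed insert.prems(2,3) in \<open>blast+\<close>)
  finally show ?case using c insert.prems(2)[of k] by (simp add: neg r_neg finsum_closed)
qed (simp only: finsum_empty)

lemma left_moduleI:
  fixes A (structure) and M (structure)
  assumes "ring A" "abelian_group M"
    and "\<And>a x. a \<in> carrier A \<Longrightarrow> x \<in> carrier M \<Longrightarrow> a \<odot>\<^bsub>M\<^esub> x \<in> carrier M"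
    and "\<And>a b x. a \<in> carrier A \<Longrightarrow> b \<in> carrier A \<Longrightarrow> x \<in> carrier M \<Longrightarrow>
      (a \<oplus>\<^bsub>A\<^esub> b) \<odot>\<^bsub>M\<^esub> x = a \<odot>\<^bsub>M\<^esub> x \<oplus>\<^bsub>M\<^esub> b \<odot>\<^bsub>M\<^esub> x"
    and "\<And>a x y. a \<in> carrier A \<Longrightarrow> x \<in> carrier M \<Longrightarrow> y \<in> carrier M \<Longrightarrow>
      a \<odot>\<^bsub>M\<^esub> (x \<oplus>\<^bsub>M\<^esub> y) = a \<odot>\<^bsub>M\<^esub> x \<oplus>\<^bsub>M\<^esub> a \<odot>\<^bsub>M\<^esub> y"
    and "\<And>a b x. a \<in> carrier A \<Longrightarrow> b \<in> carrier A \<Longrightarrow> x \<in> carrier M \<Longrightarrow>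
      (a \<otimes>\<^bsub>A\<^esub> b) \<odot>\<^bsub>M\<^esub> x = a \<odot>\<^bsub>M\<^esub> (b \<odot>\<^bsub>M\<^esub> x)"
    and "\<And>x. x \<in> carrier M \<Longrightarrow> \<one>\<^bsub>A\<^esub> \<odot>\<^bsub>M\<^esub> x = x"
  shows "left_module A M"
  by (intro left_module.intro left_module_axioms.intro assms)

lemma (in left_module) smult_r_null:
  assumes "a \<in> carrier A"
  shows "a \<odot>\<^bsub>M\<^esub> \<zero>\<^bsub>M\<^esub> = \<zero>\<^bsub>M\<^esub>"
proof -
  have "a \<odot>\<^bsub>M\<^esub> \<zero>\<^bsub>M\<^esub> \<oplus>\<^bsub>M\<^esub> a \<odot>\<^bsub>M\<^esub> \<zero>\<^bsub>M\<^esub> = a \<odot>\<^bsub>M\<^esub> \<zero>\<^bsub>M\<^esub>"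
    using assms smult_r_distr[of a "\<zero>\<^bsub>M\<^esub>" "\<zero>\<^bsub>M\<^esub>"] by simp
  then show ?thesis using assms by (simp add: M.add.r_cancel_one')
qed

lemma left_module_direct_sum:
  assumes A: "ring A" and M: "\<And>i. i \<in> I \<Longrightarrow> left_module A (M i)"
  shows "left_module A (direct_sum_module I M)"
proof -
  let ?D = "direct_sum_module I M"
  have ab: "abelian_group (M i)" if "i \<in> I" for i
    using M[OF that] by (simp add: left_module_def)
  note lm = left_module.smult_closed[OF M] left_module.smult_l_distr[OF M] left_module.smult_r_distr[OF M]
    left_module.smult_assoc1[OF M] left_module.smult_one[OF M]
  note ag = abelian_groupE[OF ab]
  have mem: "x \<in> carrier ?D" if "x \<in> (\<Pi>\<^sub>E i\<in>I. carrier (M i))" "{i \<in> I. x i \<noteq> \<zero>\<^bsub>M i\<^esub>} \<subseteq> S" "finite S" for x S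
    using that finite_subset by (auto simp: direct_sum_module_def)
  have el: "x i \<in> carrier (M i)" if "x \<in> carrier ?D" "i \<in> I" for x i
    using that by (auto simp: direct_sum_module_def)
  have fin: "finite {i \<in> I. x i \<noteq> \<zero>\<^bsub>M i\<^esub>}" if "x \<in> carrier ?D" for x
    using that by (auto simp: direct_sum_module_def)
  have ext: "x = y" if "x \<in> carrier ?D" "y \<in> carrier ?D" "\<And>i. i \<in> I \<Longrightarrow> x i = y i" for x y
    using that by (intro PiE_ext[of x I _ y]) (auto simp: direct_sum_module_def)
  have add: "x \<oplus>\<^bsub>?D\<^esub> y \<in> carrier ?D" if "x \<in> carrier ?D" "y \<in> carrier ?D" for x y
    using fin[OF that(1)] fin[OF that(2)] that
    by (intro mem[of _ "{i \<in> I. x i \<noteq> \<zero>\<^bsub>M i\<^esub>} \<union> {i \<in> I. y i \<noteq> \<zero>\<^bsub>M i\<^esub>}"])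
      (auto simp: direct_sum_module_def PiE_iff ag)
  have smult: "a \<odot>\<^bsub>?D\<^esub> x \<in> carrier ?D" if "x \<in> carrier ?D" "a \<in> carrier A" for x a
    using fin[OF that(1)] that
    by (intro mem[of _ "{i \<in> I. x i \<noteq> \<zero>\<^bsub>M i\<^esub>}"])
      (auto simp: direct_sum_module_def PiE_iff lm left_module.smult_r_null[OF M])
  have zero: "\<zero>\<^bsub>?D\<^esub> \<in> carrier ?D"
    by (intro mem[of _ "{}"]) (auto simp: direct_sum_module_def ag)
  have addv: "(x \<oplus>\<^bsub>?D\<^esub> y) i = x i \<oplus>\<^bsub>M i\<^esub> y i" and smultv: "(a \<odot>\<^bsub>?D\<^esub> x) i = a \<odot>\<^bsub>M i\<^esub> x i"
    and zerov: "\<zero>\<^bsub>?D\<^esub> i = \<zero>\<^bsub>M i\<^esub>" if "i \<in> I" for x y a i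
    using that by (simp_all add: direct_sum_module_def)
  note v = addv smultv zerov
  interpret A: ring A by fact
  show ?thesis
  proof (rule left_moduleI[OF A])
    show "abelian_group ?D"
    proof (rule abelian_groupI)
      fix x assume x: "x \<in> carrier ?D"
      define y where "y = (\<lambda>i\<in>I. \<ominus>\<^bsub>M i\<^esub> x i)"
      have "y \<in> carrier ?D"
        using fin[OF x] el[OF x]
        by (intro mem[of _ "{i \<in> I. x i \<noteq> \<zero>\<^bsub>M i\<^esub>}"])
          (auto simp: y_def abelian_group.a_inv_closed[OF ab] abelian_group.minus_equality[OF ab] ag
             intro!: abelian_group.a_inv_closed[OF ab])
      moreover from this have "y \<oplus>\<^bsub>?D\<^esub> x = \<zero>\<^bsub>?D\<^esub>"
        using x el[OF x] by (intro ext add zero) (auto simp: v y_def abelian_group.l_neg[OF ab])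
      ultimately show "\<exists>y\<in>carrier ?D. y \<oplus>\<^bsub>?D\<^esub> x = \<zero>\<^bsub>?D\<^esub>" by blast
        next
      show "x \<oplus>\<^bsub>?D\<^esub> y = y \<oplus>\<^bsub>?D\<^esub> x" if "x \<in> carrier ?D" "y \<in> carrier ?D" for x y
        using that by (intro ext add) (simp_all add: v el ag(4))
      show "x \<oplus>\<^bsub>?D\<^esub> y \<oplus>\<^bsub>?D\<^esub> z = x \<oplus>\<^bsub>?D\<^esub> (y \<oplus>\<^bsub>?D\<^esub> z)"
        if "x \<in> carrier ?D" "y \<in> carrier ?D" "z \<in> carrier ?D" for x y z
        using that by (intro ext add) (simp_all add: v el ag(3))
      show "\<zero>\<^bsub>?D\<^esub> \<oplus>\<^bsub>?D\<^esub> x = x" if "x \<in> carrier ?D" for x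
        using that by (intro ext add zero) (simp_all add: v el ag(5))
    qed (auto intro: add zero)
  next
    show "(a \<oplus>\<^bsub>A\<^esub> b) \<odot>\<^bsub>?D\<^esub> x = a \<odot>\<^bsub>?D\<^esub> x \<oplus>\<^bsub>?D\<^esub> b \<odot>\<^bsub>?D\<^esub> x"
      if "a \<in> carrier A" "b \<in> carrier A" "x \<in> carrier ?D" for a b x
      using that by (intro ext add smult) (simp_all add: v el lm(2))
    show "a \<odot>\<^bsub>?D\<^esub> (x \<oplus>\<^bsub>?D\<^esub> y) = a \<odot>\<^bsub>?D\<^esub> x \<oplus>\<^bsub>?D\<^esub> a \<odot>\<^bsub>?D\<^esub> y"
      if "a \<in> carrier A" "x \<in> carrier ?D" "y \<in> carrier ?D" for a x y
      using that by (intro ext add smult) (simp_all add: v el lm(3))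
    show "(a \<otimes>\<^bsub>A\<^esub> b) \<odot>\<^bsub>?D\<^esub> x = a \<odot>\<^bsub>?D\<^esub> (b \<odot>\<^bsub>?D\<^esub> x)"
      if "a \<in> carrier A" "b \<in> carrier A" "x \<in> carrier ?D" for a b x
      using that by (intro ext smult) (simp_all add: v el lm(4))
    show "\<one>\<^bsub>A\<^esub> \<odot>\<^bsub>?D\<^esub> x = x" if "x \<in> carrier ?D" for x
      using that by (intro ext smult) (simp_all add: v el lm(5))
  qed (rule smult)
qed

text \<open>First isomorphism theorem. Cosets of the kernel are the fibres \<open>\<psi> z\<close>
  of \<open>h\<close>, and the coset operations act on the labels z as the operations of
  \<open>N\<close> do. Hence the module axioms of the quotient are inherited from \<open>N\<close>,
  and the isomorphism is the inverse of \<open>\<psi>\<close>.\<close>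

theorem left_module_isomorphic_quotient:
  assumes M: "left_module A M" and N: "left_module A N" and h: "h \<in> left_module_hom A M N"
    and surj: "h ` carrier M = carrier N"
  shows "left_module_isomorphic A (quotient_module M {x \<in> carrier M. h x = \<zero>\<^bsub>N\<^esub>}) N"
proof -
  interpret M: left_module A M by fact
  interpret N: left_module A N by fact
  define K where "K = {x \<in> carrier M. h x = \<zero>\<^bsub>N\<^esub>}"
  define \<psi> where "\<psi> z = {x \<in> carrier M. h x = z}" for z
  let ?Q = "quotient_module M K"
  have hs: "h (a \<odot>\<^bsub>M\<^esub> x) = a \<odot>\<^bsub>N\<^esub> h x" if "x \<in> carrier M" "a \<in> carrier A" for x a
    using h that by (auto simp: left_module_hom_def)
  have hc: "h x \<in> carrier N" if "x \<in> carrier M" for x using h that by (auto simp: left_module_hom_def)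
  have ha: "h (x \<oplus>\<^bsub>M\<^esub> y) = h x \<oplus>\<^bsub>N\<^esub> h y" if "x \<in> carrier M" "y \<in> carrier M" for x y
    using h that by (auto simp: left_module_hom_def)
  have sub: "\<exists>y\<in>carrier M. y \<oplus>\<^bsub>M\<^esub> x = z \<and> h y \<oplus>\<^bsub>N\<^esub> h x = h z" if "x \<in> carrier M" "z \<in> carrier M" for x z
  proof -
    let ?y = "z \<oplus>\<^bsub>M\<^esub> \<ominus>\<^bsub>M\<^esub> x"
    have "?y \<oplus>\<^bsub>M\<^esub> x = z" using that by (simp add: M.a_assoc M.l_neg)
    then show ?thesis using that ha[of ?y x] by (intro bexI[of _ ?y]) auto
  qed
  have coset: "K +>\<^bsub>M\<^esub> x = \<psi> (h x)" if x: "x \<in> carrier M" for x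
  proof
    show "K +>\<^bsub>M\<^esub> x \<subseteq> \<psi> (h x)"
      using x by (auto simp: a_r_coset_def' K_def \<psi>_def ha hc)
    show "\<psi> (h x) \<subseteq> K +>\<^bsub>M\<^esub> x"
    proof
      fix z assume "z \<in> \<psi> (h x)"
      then have z: "z \<in> carrier M" "h z = h x" by (auto simp: \<psi>_def)
      obtain y where y: "y \<in> carrier M" "y \<oplus>\<^bsub>M\<^esub> x = z" "h y \<oplus>\<^bsub>N\<^esub> h x = h x"
        using sub[OF x z(1)] unfolding z(2) by blast
      then have "h y = \<zero>\<^bsub>N\<^esub>" using hc x by (simp add: N.add.r_cancel_one)
      then show "z \<in> K +>\<^bsub>M\<^esub> x" using y by (auto simp: a_r_coset_def' K_def)
    qed
  qed
  have carrier: "carrier ?Q = \<psi> ` carrier N"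
    unfolding surj[symmetric] by (auto simp: quotient_module_def A_RCOSETS_def' coset)
  have add: "\<psi> u \<oplus>\<^bsub>?Q\<^esub> \<psi> v = \<psi> (u \<oplus>\<^bsub>N\<^esub> v)" if uv: "u \<in> carrier N" "v \<in> carrier N" for u v
  proof
    show "\<psi> u \<oplus>\<^bsub>?Q\<^esub> \<psi> v \<subseteq> \<psi> (u \<oplus>\<^bsub>N\<^esub> v)"
      by (auto simp: quotient_module_def set_add_def' \<psi>_def ha)
    show "\<psi> (u \<oplus>\<^bsub>N\<^esub> v) \<subseteq> \<psi> u \<oplus>\<^bsub>?Q\<^esub> \<psi> v"
    proof
      fix z assume "z \<in> \<psi> (u \<oplus>\<^bsub>N\<^esub> v)"
      then have z: "z \<in> carrier M" "h z = u \<oplus>\<^bsub>N\<^esub> v" by (auto simp: \<psi>_def)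
      obtain x where x: "x \<in> carrier M" "h x = v" using uv(2)[folded surj] by blast
      obtain y where y: "y \<in> carrier M" "y \<oplus>\<^bsub>M\<^esub> x = z" "h y \<oplus>\<^bsub>N\<^esub> v = u \<oplus>\<^bsub>N\<^esub> v"
        using sub[OF x(1) z(1)] unfolding x(2) z(2) by blast
      then have "h y = u" using N.add.right_cancel[of v "h y" u] hc uv by simp
      then have "y \<in> \<psi> u" "x \<in> \<psi> v" using x y(1) by (simp_all add: \<psi>_def)
      then show "z \<in> \<psi> u \<oplus>\<^bsub>?Q\<^esub> \<psi> v"
        unfolding y(2)[symmetric] by (auto simp: quotient_module_def set_add_def')
    qed
  qed
  have smult: "a \<odot>\<^bsub>?Q\<^esub> \<psi> u = \<psi> (a \<odot>\<^bsub>N\<^esub> u)" if au: "a \<in> carrier A" "u \<in> carrier N" for a u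
  proof -
    obtain x where x: "x \<in> carrier M" "h x = u" using au(2)[folded surj] by blast
    have "K +>\<^bsub>M\<^esub> (a \<odot>\<^bsub>M\<^esub> y) = \<psi> (a \<odot>\<^bsub>N\<^esub> u)" if "y \<in> \<psi> u" for y
      using that au(1) by (auto simp: \<psi>_def coset hs)
    then show ?thesis using x by (auto simp: quotient_module_def \<psi>_def)
  qed
  have zero: "\<zero>\<^bsub>?Q\<^esub> = \<psi> \<zero>\<^bsub>N\<^esub>" by (simp add: quotient_module_def K_def \<psi>_def)
  have Q: "left_module A ?Q"
  proof (rule left_moduleI)
    show "abelian_group ?Q"
    proof (rule abelian_groupI)
      fix X assume "X \<in> carrier ?Q"
      then obtain u where u: "u \<in> carrier N" "X = \<psi> u" unfolding carrier by blast
      have "\<psi> (\<ominus>\<^bsub>N\<^esub> u) \<oplus>\<^bsub>?Q\<^esub> X = \<zero>\<^bsub>?Q\<^esub>" using u by (simp add: add zero N.l_neg)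
      then show "\<exists>Y\<in>carrier ?Q. Y \<oplus>\<^bsub>?Q\<^esub> X = \<zero>\<^bsub>?Q\<^esub>" using u unfolding carrier by auto
    qed (auto simp: carrier add zero N.a_ac)
  next
    show "ring A" using M by (simp add: left_module_def)
  qed (auto simp: carrier add smult N.smult_l_distr N.smult_r_distr N.smult_assoc1)
  have inj: "inj_on \<psi> (carrier N)"
    unfolding surj[symmetric] by (rule inj_onI) (auto simp: \<psi>_def)
  have "the_inv_into (carrier N) \<psi> \<in> left_module_hom A ?Q N"
    unfolding left_module_hom_def using inj
    by (auto simp: carrier add smult the_inv_into_f_f)
  moreover have "bij_betw (the_inv_into (carrier N) \<psi>) (carrier ?Q) (carrier N)"
    unfolding carrier by (intro bij_betw_the_inv_into inj_on_imp_bij_betw inj)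
  ultimately show ?thesis
    unfolding left_module_isomorphic_def K_def[symmetric] using Q N by blast
qed

section \<open>The grading of the Temperley--Lieb algebra\<close>

text \<open>Keeps \<open>{1..<n}\<close> in the form in which it occurs inside
  \<open>free_algebra R {1..<n}\<close>.\<close>

declare One_nat_def [simp del]

definition monomial :: "('r, 'm) ring_scheme \<Rightarrow> 'r \<Rightarrow> 'x list \<Rightarrow> 'x list \<Rightarrow> 'r"
  where "monomial R r w = (\<lambda>v. if v = w then r else \<zero>\<^bsub>R\<^esub>)"

definition restriction :: "('r, 'm) ring_scheme \<Rightarrow> ('x list \<Rightarrow> bool) \<Rightarrow> ('x list \<Rightarrow> 'r) \<Rightarrow> 'x list \<Rightarrow> 'r"
  where "restriction R P f = (\<lambda>w. if P w then f w else \<zero>\<^bsub>R\<^esub>)"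

definition red_invariant :: "(nat list \<Rightarrow> bool) \<Rightarrow> bool"
  where "red_invariant P \<longleftrightarrow> (\<forall>u v. red u v \<longrightarrow> P u = P v)"

text \<open>\<open>red\<close> is compatible with concatenation. The shifted predicates are those
  produced by \<open>restriction_mult\<close>.\<close>

lemma red_invariant_context:
  "red_invariant P \<Longrightarrow> red_invariant (\<lambda>w. P (u @ w))"
  "red_invariant P \<Longrightarrow> red_invariant (\<lambda>w. P (w @ u))"
  unfolding red_invariant_def by (blast intro: red_append red_refl)+


section \<open>Restricting coefficient functions to classes of words\<close>

context cring
begin

lemma free_scalar_monomial: "free_scalar R r = monomial R r []"
  by (simp add: free_scalar_def monomial_def)

lemma free_gen_monomial: "free_gen R i = monomial R \<one> [i]"
  by (simp add: free_gen_def monomial_def)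

lemma monomial_eval_closed: "r \<in> carrier R \<Longrightarrow> monomial R r w v \<in> carrier R"
  by (simp add: monomial_def)

lemma monomial_closed:
  "r \<in> carrier R \<Longrightarrow> set w \<subseteq> X \<Longrightarrow> monomial R r w \<in> carrier (free_algebra R X)"
  by (rule free_algebra_carrierI[of _ "{w}"]) (auto simp: monomial_def)

lemma monomial_mult:
  assumes "r \<in> carrier R" "s \<in> carrier R"
  shows "monomial R r u \<otimes>\<^bsub>free_algebra R X\<^esub> monomial R s v = monomial R (r \<otimes> s) (u @ v)"
proof
  fix w
  note c = monomial_eval_closed
  show "(monomial R r u \<otimes>\<^bsub>free_algebra R X\<^esub> monomial R s v) w = monomial R (r \<otimes> s) (u @ v) w"
  proof (induction u arbitrary: w)
    case Nil
    show ?case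
      unfolding free_scalar_monomial[symmetric]
      using assms by (subst conv_scalar) (auto simp: c monomial_def free_scalar_def)
  next
    case (Cons x u)
    show ?case
    proof (cases w)
      case Nil
      then show ?thesis using assms by (simp add: conv_Nil c monomial_def)
    next
      case w: (Cons y w')
      have "(\<lambda>v. monomial R r (x # u) (y # v)) = (if x = y then monomial R r u else (\<lambda>v. \<zero>))"
        by (auto simp: monomial_def)
      moreover have "((\<lambda>v. \<zero>) \<otimes>\<^bsub>free_algebra R X\<^esub> monomial R s v) w' = \<zero>"
        using assms by (simp add: free_algebra_def c)
      ultimately have "(monomial R r (x # u) \<otimes>\<^bsub>free_algebra R X\<^esub> monomial R s v) w =
          (if x = y then monomial R (r \<otimes> s) (u @ v) w' else \<zero>)"
        using assms Cons.IH[of w'] by (simp add: w conv_Cons c) (simp add: monomial_def)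
      then show ?thesis by (auto simp: w monomial_def)
    qed
  qed
qed

lemma free_algebra_induct [consumes 1, case_names zero add monomial]:
  assumes "f \<in> carrier (free_algebra R X)"
    and zero: "P \<zero>\<^bsub>free_algebra R X\<^esub>"
    and add: "\<And>f g. f \<in> carrier (free_algebra R X) \<Longrightarrow> g \<in> carrier (free_algebra R X) \<Longrightarrow>
      P f \<Longrightarrow> P g \<Longrightarrow> P (f \<oplus>\<^bsub>free_algebra R X\<^esub> g)"
    and monomial: "\<And>r w. r \<in> carrier R \<Longrightarrow> set w \<subseteq> X \<Longrightarrow> P (monomial R r w)"
  shows "P f"
proof -
  have "P f" if "finite S" "f \<in> carrier (free_algebra R X)" "{w. f w \<noteq> \<zero>} \<subseteq> S" for S f
    using that
  proof (induction S arbitrary: f)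
    case empty
    then have "f = \<zero>\<^bsub>free_algebra R X\<^esub>" by (auto simp: free_algebra_def)
    then show ?case using zero by simp
  next
    case (insert w S)
    show ?case
    proof (cases "f w = \<zero>")
      case True
      then show ?thesis using insert by blast
    next
      case False
      define g where "g = f(w := \<zero>)"
      have fc: "f v \<in> carrier R" for v using insert.prems by (simp add: free_algebra_def)
      have w: "set w \<subseteq> X" using False insert.prems by (auto simp: free_algebra_def)
      have "f = g \<oplus>\<^bsub>free_algebra R X\<^esub> monomial R (f w) w"
        using fc by (auto simp: free_algebra_def monomial_def g_def)
      moreover have g: "g \<in> carrier (free_algebra R X)"
        by (rule free_algebra_carrierI[of _ "{w. f w \<noteq> \<zero>}"])
          (use insert.prems in \<open>auto simp: free_algebra_def g_def\<close>)
      moreover have "P g" by (rule insert.IH[OF g]) (use insert.prems in \<open>auto simp: g_def\<close>)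
      ultimately show ?thesis using add[of g "monomial R (f w) w"] monomial monomial_closed w fc by metis
    qed
  qed
  moreover have "finite {w. f w \<noteq> \<zero>}" using assms(1) by (simp add: free_algebra_def)
  ultimately show ?thesis using assms(1) by blast
qed

lemma restriction_hom: "abelian_group_hom (free_algebra R X) (free_algebra R X) (restriction R P)"
proof -
  interpret A: abelian_group "free_algebra R X" by (rule free_algebra_abelian_group)
  have "restriction R P f \<in> carrier (free_algebra R X)" if "f \<in> carrier (free_algebra R X)" for f
    by (rule free_algebra_carrierI[of _ "{w. f w \<noteq> \<zero>}"])
      (use that in \<open>auto simp: free_algebra_def restriction_def\<close>)
  then show ?thesis
    by (intro abelian_group_homI group_hom.intro group_hom_axioms.intro homI A.a_group
        A.abelian_group_axioms) (auto simp: free_algebra_def restriction_def)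
qed

lemma restriction_monomial:
  "restriction R P (monomial R r w) = (if P w then monomial R r w else (\<lambda>_. \<zero>))"
  by (auto simp: restriction_def monomial_def)

lemma restriction_mult:
  assumes "f \<in> carrier (free_algebra R X)" "r \<in> carrier R" "set u \<subseteq> X"
  shows "restriction R P (monomial R r u \<otimes>\<^bsub>free_algebra R X\<^esub> f) =
      monomial R r u \<otimes>\<^bsub>free_algebra R X\<^esub> restriction R (\<lambda>w. P (u @ w)) f" (is ?l)
    and "restriction R P (f \<otimes>\<^bsub>free_algebra R X\<^esub> monomial R r u) =
      restriction R (\<lambda>w. P (w @ u)) f \<otimes>\<^bsub>free_algebra R X\<^esub> monomial R r u" (is ?r)
proof -
  interpret A: ring "free_algebra R X" by (rule free_algebra_ring)
  interpret h: abelian_group_hom "free_algebra R X" "free_algebra R X" "restriction R P" for P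
    by (rule restriction_hom)
  have m: "monomial R r u \<in> carrier (free_algebra R X)" using assms by (simp add: monomial_closed)
  have z: "(\<lambda>_. \<zero>) = \<zero>\<^bsub>free_algebra R X\<^esub>" by (simp add: free_algebra_def)
  show ?l using assms(1)
  proof (induction rule: free_algebra_induct)
    case zero
    then show ?case using m by simp
  next
    case (add f g)
    then show ?case using m by (simp add: A.r_distr)
  next
    case (monomial s w)
    then show ?case using assms m by (simp add: monomial_mult restriction_monomial z)
  qed
  show ?r using assms(1)
  proof (induction rule: free_algebra_induct)
    case zero
    then show ?case using m by simp
  next
    case (add f g)
    then show ?case using m by (simp add: A.l_distr)
  next
    case (monomial s w)
    then show ?case using assms m by (simp add: monomial_mult restriction_monomial z)
  qed
qed

lemma TL_relators_monomial:
  assumes "a \<in> carrier R"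
  shows "TL_relators R n a = {monomial R \<one> [i, j] \<ominus>\<^bsub>free_algebra R {1..<n}\<^esub> monomial R \<one> [j, i] | i j.
        i \<in> {1..<n} \<and> j \<in> {1..<n} \<and> \<bar>int i - int j\<bar> \<ge> 2} \<union>
     {monomial R \<one> [i, j, i] \<ominus>\<^bsub>free_algebra R {1..<n}\<^esub> monomial R \<one> [i] | i j.
        i \<in> {1..<n} \<and> j \<in> {1..<n} \<and> (j = i + 1 \<or> i = j + 1)} \<union>
     {monomial R \<one> [i, i] \<ominus>\<^bsub>free_algebra R {1..<n}\<^esub> monomial R a [i] | i. i \<in> {1..<n}}"
  using assms by (simp add: TL_relators_def Let_def free_gen_monomial free_scalar_monomial monomial_mult)

text \<open>The common shape of the three relations, with \<open>c\<close> equal to 1 or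
  \<open>a\<close>. An invariant predicate keeps both terms of a relator or drops both.\<close>

lemma TL_relators_red:
  assumes "a \<in> carrier R" "f \<in> TL_relators R n a"
  shows "\<exists>u v c. f = monomial R \<one> u \<ominus>\<^bsub>free_algebra R {1..<n}\<^esub> monomial R c v \<and> c \<in> carrier R \<and>
    red u v \<and> set u \<subseteq> {1..<n} \<and> set v \<subseteq> {1..<n}"
proof -
  consider i j where "f = monomial R \<one> [i, j] \<ominus>\<^bsub>free_algebra R {1..<n}\<^esub> monomial R \<one> [j, i]"
      "i \<in> {1..<n}" "j \<in> {1..<n}" "\<bar>int i - int j\<bar> \<ge> 2"
    | i j where "f = monomial R \<one> [i, j, i] \<ominus>\<^bsub>free_algebra R {1..<n}\<^esub> monomial R \<one> [i]"
      "i \<in> {1..<n}" "j \<in> {1..<n}" "j = i + 1 \<or> i = j + 1"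
    | i where "f = monomial R \<one> [i, i] \<ominus>\<^bsub>free_algebra R {1..<n}\<^esub> monomial R a [i]" "i \<in> {1..<n}"
    using assms(2) unfolding TL_relators_monomial[OF assms(1)] by blast
  then show ?thesis
  proof cases
    case (1 i j)
    then show ?thesis using red_comm[of i j]
      by (intro exI[of _ "[i, j]"] exI[of _ "[j, i]"] exI[of _ \<one>]) auto
  next
    case (2 i j)
    then show ?thesis using red_braid[of j i]
      by (intro exI[of _ "[i, j, i]"] exI[of _ "[i]"] exI[of _ \<one>]) auto
  next
    case (3 i)
    then show ?thesis using red_square[of i] assms(1)
      by (intro exI[of _ "[i, i]"] exI[of _ "[i]"] exI[of _ a]) auto
  qed
qed

lemma restriction_TL_ideal:
  assumes a: "a \<in> carrier R" and f: "f \<in> TL_ideal R n a" and P: "red_invariant P"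
  shows "restriction R P f \<in> TL_ideal R n a"
proof -
  let ?A = "free_algebra R {1..<n}" and ?I = "TL_ideal R n a"
  interpret A: ring ?A by (rule free_algebra_ring)
  interpret I: ideal ?I ?A by (rule TL_ideal[OF a])
  interpret h: abelian_group_hom ?A ?A "restriction R P" for P by (rule restriction_hom)
  \<comment> \<open>Quantifying over all invariant predicates is what makes \<open>K\<close> an
    ideal: multiplying by a word turns the restriction along P into one along a shift of P, which is
    again invariant.\<close>
  define K where "K = {f \<in> carrier ?A. \<forall>P. red_invariant P \<longrightarrow> restriction R P f \<in> ?I}"
  have mult: "x \<otimes>\<^bsub>?A\<^esub> f \<in> K \<and> f \<otimes>\<^bsub>?A\<^esub> x \<in> K" if f: "f \<in> K" and "x \<in> carrier ?A" for f x
    using that(2)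
  proof (induction rule: free_algebra_induct)
    case zero
    then show ?case using f by (simp add: K_def)
  next
    case (add x y)
    then show ?case using f by (simp add: K_def A.l_distr A.r_distr)
  next
    case (monomial r w)
    then have m: "monomial R r w \<in> carrier ?A" by (rule monomial_closed)
    have "restriction R (\<lambda>v. P (w @ v)) f \<in> ?I" "restriction R (\<lambda>v. P (v @ w)) f \<in> ?I"
      if "red_invariant P" for P
      using f red_invariant_context[OF that] by (simp_all add: K_def)
    then show ?case using f m monomial
      by (simp add: K_def restriction_mult I.I_l_closed I.I_r_closed)
  qed
  have "ideal K ?A"
  proof (rule idealI[OF A.ring_axioms])
    show "subgroup K (add_monoid ?A)"
      by (rule A.add.subgroupI) (auto simp: K_def)
  qed (use mult in auto)
  moreover have z: "(\<lambda>_. \<zero>) = \<zero>\<^bsub>?A\<^esub>" by (simp add: free_algebra_def)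
  have "TL_relators R n a \<subseteq> K"
  proof
    fix g assume g: "g \<in> TL_relators R n a"
    then obtain u v c where uvc: "g = monomial R \<one> u \<ominus>\<^bsub>?A\<^esub> monomial R c v" "c \<in> carrier R" "red u v"
        "set u \<subseteq> {1..<n}" "set v \<subseteq> {1..<n}"
      using TL_relators_red[OF a] by meson
    have c: "monomial R \<one> u \<in> carrier ?A" "monomial R c v \<in> carrier ?A"
      using uvc by (auto intro: monomial_closed)
    have "restriction R P g \<in> ?I" if "red_invariant P" for P
    proof (cases "P u")
      case True
      then have "restriction R P g = g"
        using that uvc(3) c by (simp add: uvc(1) A.minus_eq restriction_monomial red_invariant_def)
      then show ?thesis using g A.genideal_self[OF TL_relators_closed[OF a]] by (auto simp: TL_ideal_def)
    next
      case False
      then have "restriction R P g = \<zero>\<^bsub>?A\<^esub>"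
        using that uvc(3) c z
        by (simp add: uvc(1) A.minus_eq restriction_monomial red_invariant_def)
      then show ?thesis by simp
    qed
    then show "g \<in> K" using c by (simp add: K_def uvc(1))
  qed
  ultimately have "?I \<subseteq> K"
    unfolding TL_ideal_def by (rule A.genideal_minimal)
  then show ?thesis using f P by (auto simp: K_def)
qed

end

section \<open>Spanning words of the algebra and projections along invariant predicates\<close>

locale temperley_lieb = cring R for R (structure) +
  fixes n :: nat and a
  assumes a_closed: "a \<in> carrier R"
begin

abbreviation "A \<equiv> free_algebra R {1..<n}"
abbreviation "T \<equiv> TL R n a"

definition word :: "'a \<Rightarrow> nat list \<Rightarrow> (nat list \<Rightarrow> 'a) set"
  where "word r w = TL_class R n a (monomial R r w)"

sublocale A: ring A by (rule free_algebra_ring)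

sublocale I: ideal "TL_ideal R n a" A by (rule TL_ideal[OF a_closed])

sublocale T: ring T by (rule TL_ring[OF a_closed])

sublocale quot: ring_hom_ring A T "TL_class R n a"
proof -
  have "TL_class R n a = (+>\<^bsub>A\<^esub>) (TL_ideal R n a)"
    by (simp add: TL_class_def fun_eq_iff)
  then show "ring_hom_ring A T (TL_class R n a)"
    using I.rcos_ring_hom_ring by (simp add: TL_def)
qed

lemma class_eq:
  assumes "f \<in> carrier A" "g \<in> carrier A"
  shows "TL_class R n a f = TL_class R n a g \<longleftrightarrow> f \<ominus>\<^bsub>A\<^esub> g \<in> TL_ideal R n a"
  unfolding TL_class_def
  by (rule A.quotient_eq_iff_same_a_r_cos[OF I.ideal_axioms assms, symmetric])

lemma word_closed: "r \<in> carrier R \<Longrightarrow> set w \<subseteq> {1..<n} \<Longrightarrow> word r w \<in> carrier T"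
  by (simp add: word_def monomial_closed)

lemma word_mult:
  assumes "r \<in> carrier R" "s \<in> carrier R" "set u \<subseteq> {1..<n}" "set v \<subseteq> {1..<n}"
  shows "word r u \<otimes>\<^bsub>T\<^esub> word s v = word (r \<otimes> s) (u @ v)"
  using assms unfolding word_def
  by (subst quot.hom_mult[symmetric]) (auto simp: monomial_closed monomial_mult)

lemma TL_induct [consumes 1, case_names zero add word]:
  assumes "x \<in> carrier T" "P \<zero>\<^bsub>T\<^esub>"
    and "\<And>x y. x \<in> carrier T \<Longrightarrow> y \<in> carrier T \<Longrightarrow> P x \<Longrightarrow> P y \<Longrightarrow> P (x \<oplus>\<^bsub>T\<^esub> y)"
    and "\<And>r w. r \<in> carrier R \<Longrightarrow> set w \<subseteq> {1..<n} \<Longrightarrow> P (word r w)"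
  shows "P x"
proof -
  obtain f where f: "f \<in> carrier A" "x = TL_class R n a f"
    using assms(1) unfolding TL_carrier by blast
  have "P (TL_class R n a f)" using f(1)
  proof (induction rule: free_algebra_induct)
    case zero
    then show ?case using assms(2) by simp
  next
    case (add f g)
    then show ?case using assms(3) by simp
  next
    case (monomial r w)
    then show ?case using assms(4) by (simp add: word_def)
  qed
  then show ?thesis by (simp add: f(2))
qed

text \<open>The scalar collects one factor \<open>a\<close> for each use of
  \<open>red_square\<close>, that is, for each loop that \<open>red\<close> forgets.\<close>

lemma word_red:
  assumes "red u v" "set u \<subseteq> {1..<n}"
  shows "\<exists>c\<in>carrier R. word \<one> u = word c v"
  using assms
proof (induction rule: red.induct)
  case (red_refl w)
  then show ?case by blast
next
  case (red_trans u v w)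
  then have v: "set v \<subseteq> {1..<n}" and w: "set w \<subseteq> {1..<n}" using red_set by blast+
  obtain c d where "c \<in> carrier R" "word \<one> u = word c v" "d \<in> carrier R" "word \<one> v = word d w"
    using red_trans v by blast
  then have "word \<one> u = word c [] \<otimes>\<^bsub>T\<^esub> word d w" "c \<in> carrier R" "d \<in> carrier R"
    using v word_mult[of c \<one> "[]" v] by simp_all
  then show ?case using w word_mult[of c d "[]" w] by auto
next
  case (red_context u v x y)
  then have s: "set u \<subseteq> {1..<n}" "set v \<subseteq> {1..<n}" "set x \<subseteq> {1..<n}" "set y \<subseteq> {1..<n}"
    using red_set[OF red_context.hyps] by auto
  then obtain c where c: "c \<in> carrier R" "word \<one> u = word c v" using red_context by blast
  have "word \<one> (x @ u @ y) = word \<one> x \<otimes>\<^bsub>T\<^esub> (word \<one> u \<otimes>\<^bsub>T\<^esub> word \<one> y)"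
    using s by (simp add: word_mult)
  also have "\<dots> = word c (x @ v @ y)" using s c by (simp add: word_mult)
  finally show ?case using c(1) by blast
next
  case (red_comm i j)
  then have "monomial R \<one> [i, j] \<ominus>\<^bsub>A\<^esub> monomial R \<one> [j, i] \<in> TL_relators R n a"
    unfolding TL_relators_monomial[OF a_closed] by auto
  then show ?case
    using red_comm class_eq[of "monomial R \<one> [i, j]" "monomial R \<one> [j, i]"]
      A.genideal_self[OF TL_relators_closed[OF a_closed]]
    by (intro bexI[of _ \<one>]) (auto simp: word_def TL_ideal_def monomial_closed)
next
  case (red_braid j i)
  then have "monomial R \<one> [i, j, i] \<ominus>\<^bsub>A\<^esub> monomial R \<one> [i] \<in> TL_relators R n a"
    unfolding TL_relators_monomial[OF a_closed] by auto
  then show ?case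
    using red_braid class_eq[of "monomial R \<one> [i, j, i]" "monomial R \<one> [i]"]
      A.genideal_self[OF TL_relators_closed[OF a_closed]]
    by (intro bexI[of _ \<one>]) (auto simp: word_def TL_ideal_def monomial_closed)
next
  case (red_square i)
  then have "monomial R \<one> [i, i] \<ominus>\<^bsub>A\<^esub> monomial R a [i] \<in> TL_relators R n a"
    unfolding TL_relators_monomial[OF a_closed] by auto
  then show ?case
    using red_square a_closed class_eq[of "monomial R \<one> [i, i]" "monomial R a [i]"]
      A.genideal_self[OF TL_relators_closed[OF a_closed]]
    by (intro bexI[of _ a]) (auto simp: word_def TL_ideal_def monomial_closed)
qed

text \<open>The choice of representative in \<open>proj\<close> is immaterial only if \<open>P\<close> is invariant, see \<open>proj_class\<close>.\<close>

definition proj :: "(nat list \<Rightarrow> bool) \<Rightarrow> (nat list \<Rightarrow> 'a) set \<Rightarrow> (nat list \<Rightarrow> 'a) set"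
  where "proj P x = TL_class R n a (restriction R P (SOME f. f \<in> carrier A \<and> TL_class R n a f = x))"

text \<open>Two representatives differ by an element of the ideal, and by
  \<open>restriction_TL_ideal\<close> so do their restrictions.\<close>

lemma proj_class:
  assumes P: "red_invariant P" and f: "f \<in> carrier A"
  shows "proj P (TL_class R n a f) = TL_class R n a (restriction R P f)"
proof -
  interpret h: abelian_group_hom A A "restriction R P" by (rule restriction_hom)
  define g where "g = (SOME g. g \<in> carrier A \<and> TL_class R n a g = TL_class R n a f)"
  have g: "g \<in> carrier A" "TL_class R n a g = TL_class R n a f"
    using someI[of "\<lambda>g. g \<in> carrier A \<and> TL_class R n a g = TL_class R n a f" f] f
    unfolding g_def by auto
  then have "restriction R P (g \<ominus>\<^bsub>A\<^esub> f) \<in> TL_ideal R n a"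
    using f by (intro restriction_TL_ideal a_closed P) (simp flip: class_eq)
  then show ?thesis
    using f g by (simp add: proj_def g_def[symmetric] class_eq A.minus_eq)
qed

lemma proj_hom: "red_invariant P \<Longrightarrow> abelian_group_hom T T (proj P)"
proof -
  assume P: "red_invariant P"
  interpret h: abelian_group_hom A A "restriction R P" by (rule restriction_hom)
  have "proj P \<in> hom (add_monoid T) (add_monoid T)"
  proof (rule homI)
    fix x y assume "x \<in> carrier (add_monoid T)" "y \<in> carrier (add_monoid T)"
    then obtain f g where "f \<in> carrier A" "x = TL_class R n a f" "g \<in> carrier A" "y = TL_class R n a g"
      unfolding TL_carrier by auto
    then show "proj P (x \<otimes>\<^bsub>add_monoid T\<^esub> y) = proj P x \<otimes>\<^bsub>add_monoid T\<^esub> proj P y"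
      by (simp add: proj_class[OF P] flip: quot.hom_add)
  next
    fix x assume "x \<in> carrier (add_monoid T)"
    then obtain f where "f \<in> carrier A" "x = TL_class R n a f"
      unfolding TL_carrier by auto
    then show "proj P x \<in> carrier (add_monoid T)" by (simp add: proj_class[OF P])
  qed
  then show ?thesis
    by (intro abelian_group_homI group_hom.intro group_hom_axioms.intro
      T.a_group T.abelian_group_axioms)
qed

lemma proj_word:
  assumes "red_invariant P" "r \<in> carrier R" "set w \<subseteq> {1..<n}"
  shows "proj P (word r w) = (if P w then word r w else \<zero>\<^bsub>T\<^esub>)"
proof -
  have "(\<lambda>_. \<zero>) = \<zero>\<^bsub>A\<^esub>" by (simp add: free_algebra_def)
  then show ?thesis
    using assms by (simp add: word_def proj_class monomial_closed restriction_monomial)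
qed

section \<open>Cup(F) as a span of words\<close>

lemma Cup_elem_word:
  assumes "F \<subseteq> {1..<n}"
  shows "Cup_elem R n a F = word \<one> (sorted_list_of_set F)"
proof -
  have "foldr (\<lambda>i x. TL_gen R n a i \<otimes>\<^bsub>T\<^esub> x) ws \<one>\<^bsub>T\<^esub> = word \<one> ws" if "set ws \<subseteq> {1..<n}" for ws
    using that
  proof (induction ws)
    case Nil
    have "monomial R \<one> [] = \<one>\<^bsub>A\<^esub>" by (auto simp: monomial_def free_algebra_def)
    then show ?case by (simp add: word_def)
  next
    case (Cons i ws)
    have "TL_gen R n a i = word \<one> [i]" by (simp add: TL_gen_def word_def free_gen_monomial)
    then show ?case using Cons by (simp add: word_mult)
  qed
  moreover have "finite F" using assms finite_subset by blast
  ultimately show ?thesis using assms by (simp add: Cup_elem_def)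
qed

abbreviation "cup F \<equiv> carrier (Cup R n a F)"

lemma Cup_simps:
  "\<zero>\<^bsub>Cup R n a F\<^esub> = \<zero>\<^bsub>T\<^esub>" "x \<oplus>\<^bsub>Cup R n a F\<^esub> y = x \<oplus>\<^bsub>T\<^esub> y" "x \<odot>\<^bsub>Cup R n a F\<^esub> y = x \<otimes>\<^bsub>T\<^esub> y"
  by (simp_all add: Cup_def regular_module_def)

lemma carrier_Cup:
  "F \<subseteq> {1..<n} \<Longrightarrow> cup F = {x \<otimes>\<^bsub>T\<^esub> word \<one> (sorted_list_of_set F) | x. x \<in> carrier T}"
  by (simp add: Cup_def Cup_elem_word)

lemma set_sorted_list_subset: "F \<subseteq> {1..<n} \<Longrightarrow> set (sorted_list_of_set F) \<subseteq> {1..<n}"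
  using finite_subset[of F "{1..<n}"] by simp

lemma Cup_closed:
  assumes F: "F \<subseteq> {1..<n}"
  shows "x \<in> cup F \<Longrightarrow> x \<in> carrier T" "\<zero>\<^bsub>T\<^esub> \<in> cup F"
    and "x \<in> cup F \<Longrightarrow> y \<in> cup F \<Longrightarrow> x \<oplus>\<^bsub>T\<^esub> y \<in> cup F"
    and "x \<in> carrier T \<Longrightarrow> y \<in> cup F \<Longrightarrow> x \<otimes>\<^bsub>T\<^esub> y \<in> cup F"
    and "x \<in> cup F \<Longrightarrow> \<ominus>\<^bsub>T\<^esub> x \<in> cup F"
proof -
  let ?e = "word \<one> (sorted_list_of_set F)"
  have e: "?e \<in> carrier T" using set_sorted_list_subset[OF F] by (simp add: word_closed)
  note c = carrier_Cup[OF F]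
  show "x \<in> cup F \<Longrightarrow> x \<in> carrier T" using e by (auto simp: c)
  show "\<zero>\<^bsub>T\<^esub> \<in> cup F" unfolding c using T.l_null[OF e, symmetric] by blast
  show "x \<oplus>\<^bsub>T\<^esub> y \<in> cup F" if xy: "x \<in> cup F" "y \<in> cup F"
  proof -
    obtain p q where "p \<in> carrier T" "x = p \<otimes>\<^bsub>T\<^esub> ?e" "q \<in> carrier T" "y = q \<otimes>\<^bsub>T\<^esub> ?e"
      using xy unfolding c by blast
    then show ?thesis using e unfolding c
      by (intro CollectI exI[of _ "p \<oplus>\<^bsub>T\<^esub> q"]) (simp add: T.l_distr)
  qed
  show mult: "x \<otimes>\<^bsub>T\<^esub> y \<in> cup F" if xy: "x \<in> carrier T" "y \<in> cup F" for x
  proof -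
    obtain q where "q \<in> carrier T" "y = q \<otimes>\<^bsub>T\<^esub> ?e"
      using xy unfolding c by blast
    then show ?thesis using e xy unfolding c
      by (intro CollectI exI[of _ "x \<otimes>\<^bsub>T\<^esub> q"]) (simp add: T.m_assoc)
  qed
  show "\<ominus>\<^bsub>T\<^esub> x \<in> cup F" if x: "x \<in> cup F"
  proof -
    obtain p where "p \<in> carrier T" "x = p \<otimes>\<^bsub>T\<^esub> ?e"
      using x unfolding c by blast
    then show ?thesis using e unfolding c
      by (intro CollectI exI[of _ "\<ominus>\<^bsub>T\<^esub> p"]) (simp add: T.l_minus)
  qed
qed

lemma Cup_left_module:
  assumes F: "F \<subseteq> {1..<n}"
  shows "left_module T (Cup R n a F)"
proof (rule left_moduleI[OF T.ring_axioms])
  note c = Cup_closed[OF F]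
  show "abelian_group (Cup R n a F)"
  proof (rule abelian_groupI)
    fix x assume "x \<in> cup F"
    then show "\<exists>y\<in>cup F. y \<oplus>\<^bsub>Cup R n a F\<^esub> x = \<zero>\<^bsub>Cup R n a F\<^esub>"
      using c by (intro bexI[of _ "\<ominus>\<^bsub>T\<^esub> x"]) (auto simp: Cup_simps T.l_neg)
  qed (use c in \<open>auto simp: Cup_simps T.a_ac\<close>)
qed (use Cup_closed[OF F] in \<open>auto simp: Cup_simps T.l_distr T.r_distr T.m_assoc\<close>)

text \<open>One half of the description of Cup(F) by cups, cast as an induction rule: multiplying
  any spanning word by the generator of Cup(F) appends the letters of F. The other half is
  \<open>word_in_Cup\<close>.\<close>

lemma Cup_induct [consumes 2, case_names zero add word]:
  assumes "x \<in> cup F" "innermost n F" "P \<zero>\<^bsub>T\<^esub>"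
    and "\<And>x y. x \<in> cup F \<Longrightarrow> y \<in> cup F \<Longrightarrow> P x \<Longrightarrow> P y \<Longrightarrow> P (x \<oplus>\<^bsub>T\<^esub> y)"
    and "\<And>r w. r \<in> carrier R \<Longrightarrow> set w \<subseteq> {1..<n} \<Longrightarrow> F \<subseteq> cups w \<Longrightarrow> P (word r w)"
  shows "P x"
proof -
  let ?e = "word \<one> (sorted_list_of_set F)"
  have F: "F \<subseteq> {1..<n}" using assms(2) by (simp add: innermost_def)
  have s: "set (sorted_list_of_set F) \<subseteq> {1..<n}" using F by (rule set_sorted_list_subset)
  have e: "?e \<in> carrier T" using s by (simp add: word_closed)
  obtain t where t: "t \<in> carrier T" "x = t \<otimes>\<^bsub>T\<^esub> ?e"
    using assms(1) unfolding carrier_Cup[OF F] by blast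
  have "P (t \<otimes>\<^bsub>T\<^esub> ?e)" using t(1)
  proof (induction rule: TL_induct)
    case zero
    then show ?case using e assms(3) by simp
  next
    case (add y z)
    then show ?case using e assms(4)[of "y \<otimes>\<^bsub>T\<^esub> ?e" "z \<otimes>\<^bsub>T\<^esub> ?e"]
      by (auto simp: T.l_distr carrier_Cup[OF F])
  next
    case (word r w)
    moreover have "F \<subseteq> cups (w @ sorted_list_of_set F)"
      using cups_append_innermost[OF assms(2)] by blast
    ultimately show ?case using s assms(5)[of r "w @ sorted_list_of_set F"] by (simp add: word_mult)
  qed
  then show ?thesis by (simp add: t(2))
qed

text \<open>\<open>red_ends_with_cups\<close> brings the letters of F to the end of
  \<open>w\<close>, and the scalar picked up on the way goes into the left factor.\<close>

lemma word_in_Cup: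
  assumes "F \<subseteq> cups w" "set w \<subseteq> {1..<n}" "r \<in> carrier R"
  shows "word r w \<in> cup F"
proof -
  have F: "F \<subseteq> {1..<n}" using assms cups_subset_set[of w] by blast
  obtain u where u: "red w (u @ sorted_list_of_set F)" using red_ends_with_cups assms(1) by blast
  then have s: "set u \<subseteq> {1..<n}" "set (sorted_list_of_set F) \<subseteq> {1..<n}"
    using red_set[OF u] assms(2) by auto
  obtain c where c: "c \<in> carrier R" "word \<one> w = word c (u @ sorted_list_of_set F)"
    using word_red[OF u assms(2)] by blast
  have "word r w = word r [] \<otimes>\<^bsub>T\<^esub> word \<one> w"
    using assms by (simp add: word_mult)
  also have "\<dots> = word (r \<otimes> c) u \<otimes>\<^bsub>T\<^esub> word \<one> (sorted_list_of_set F)"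
    using assms s c by (simp add: word_mult)
  finally show ?thesis using assms c s unfolding carrier_Cup[OF F]
    by (intro CollectI exI[of _ "word (r \<otimes> c) u"]) (simp add: word_closed)
qed

lemma Cup_mono:
  assumes "F \<subseteq> G" "innermost n G" "x \<in> cup G"
  shows "x \<in> cup F"
proof -
  have F: "F \<subseteq> {1..<n}" using assms by (auto simp: innermost_def)
  show ?thesis using assms(3,2)
  proof (induction rule: Cup_induct)
    case (word r w)
    then show ?case using assms(1) by (intro word_in_Cup) auto
  qed (auto intro: Cup_closed[OF F])
qed

text \<open>The contraction cones off the least cup, so the grading by all cups is coarsened to this
  one. A word without cups belongs to none of these classes.\<close>

definition first_cup :: "nat \<Rightarrow> nat list \<Rightarrow> bool"
  where "first_cup s w \<longleftrightarrow> s \<in> cups w \<and> (\<forall>t\<in>cups w. s \<le> t)"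

lemma red_invariant_first_cup: "red_invariant (first_cup s)"
  unfolding red_invariant_def first_cup_def using red_cups by simp

abbreviation "pr s \<equiv> proj (first_cup s)"

sublocale pr: abelian_group_hom T T "pr s" for s
  by (rule proj_hom[OF red_invariant_first_cup])

lemma pr_word:
  assumes "r \<in> carrier R" "set w \<subseteq> {1..<n}"
  shows "pr s (word r w) = (if first_cup s w then word r w else \<zero>\<^bsub>T\<^esub>)"
  using assms by (rule proj_word[OF red_invariant_first_cup])

lemma pr_Cup:
  assumes x: "x \<in> cup F" and F: "innermost n F" and s: "s \<in> {1..<n}"
  shows "pr s x \<in> cup (insert s F)"
proof -
  have sF: "insert s F \<subseteq> {1..<n}" and F': "F \<subseteq> {1..<n}" using F s by (auto simp: innermost_def)
  show ?thesis using x F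
  proof (induction rule: Cup_induct)
    case zero
    show ?case using Cup_closed(2)[OF sF] by simp
  next
    case (add x y)
    then show ?case using Cup_closed(1)[OF F'] Cup_closed(3)[OF sF] by simp
  next
    case (word r w)
    then have "word r w \<in> cup (insert s F)" if "first_cup s w"
      using that by (intro word_in_Cup) (auto simp: first_cup_def)
    then show ?case using Cup_closed(2)[OF sF] word by (simp add: pr_word)
  qed
qed

text \<open>A spanning word of Cup(F) that survives \<open>pr s\<close> has cups at
  \<open>insert s F\<close> and none below \<open>s\<close>. The first conflicts with
  \<open>insert s F\<close> not being innermost, the second with a smaller element of F.\<close>

lemma pr_zero:
  assumes x: "x \<in> cup F" and F: "innermost n F" and s: "\<not> innermost n (insert s F) \<or> (\<exists>t\<in>F. t < s)"
  shows "pr s x = \<zero>\<^bsub>T\<^esub>"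
proof -
  have F': "F \<subseteq> {1..<n}" using F by (simp add: innermost_def)
  show ?thesis using x F
  proof (induction rule: Cup_induct)
    case (add x y)
    then show ?case using Cup_closed(1)[OF F'] by simp
  next
    case (word r w)
    have "\<not> first_cup s w"
    proof
      assume "first_cup s w"
      then have "insert s F \<subseteq> cups w" "\<not> (\<exists>t\<in>F. t < s)"
        using word by (auto simp: first_cup_def not_less)
      then show False using s innermost_subset innermost_cups[OF word(2)] by blast
    qed
    then show ?case using word by (simp add: pr_word)
  qed simp
qed

lemma augmentation_word:
  "r \<in> carrier R \<Longrightarrow> set w \<subseteq> {1..<n} \<Longrightarrow> TL_augmentation (word r w) = (if w = [] then r else \<zero>)"
  by (simp add: word_def TL_augmentation_class[OF a_closed] monomial_closed) (simp add: monomial_def)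

sublocale augmentation: ring_hom_ring T R TL_augmentation
  by (rule ring_hom_ringI2[OF T.ring_axioms ring_axioms TL_augmentation(1)[OF a_closed]])

lemma word_Nil_add: "r \<in> carrier R \<Longrightarrow> s \<in> carrier R \<Longrightarrow> word (r \<oplus> s) [] = word r [] \<oplus>\<^bsub>T\<^esub> word s []"
proof -
  assume "r \<in> carrier R" "s \<in> carrier R"
  moreover from this have "monomial R (r \<oplus> s) [] = monomial R r [] \<oplus>\<^bsub>A\<^esub> monomial R s []"
    by (auto simp: monomial_def free_algebra_def)
  ultimately show ?thesis by (simp add: word_def monomial_closed)
qed

text \<open>A nonempty word has a cup at its last letter, hence exactly one least cup. Only the
  empty word escapes all the projections, and the augmentation reads off its coefficient. This is
  the source of the homology in degree 0.\<close>

lemma sum_pr: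
  assumes "x \<in> carrier T"
  shows "(\<Oplus>\<^bsub>T\<^esub>s\<in>{1..<n}. pr s x) \<oplus>\<^bsub>T\<^esub> word (TL_augmentation x) [] = x"
  using assms
proof (induction rule: TL_induct)
  case zero
  have "monomial R \<zero> [] = \<zero>\<^bsub>A\<^esub>" by (auto simp: monomial_def free_algebra_def)
  then show ?case by (simp add: word_def T.finsum_zero)
next
  case (add x y)
  then have "(\<Oplus>\<^bsub>T\<^esub>s\<in>{1..<n}. pr s (x \<oplus>\<^bsub>T\<^esub> y)) = (\<Oplus>\<^bsub>T\<^esub>s\<in>{1..<n}. pr s x) \<oplus>\<^bsub>T\<^esub> (\<Oplus>\<^bsub>T\<^esub>s\<in>{1..<n}. pr s y)"
    by (simp add: T.finsum_addf)
  moreover have "word (TL_augmentation (x \<oplus>\<^bsub>T\<^esub> y)) [] =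
     word (TL_augmentation x) [] \<oplus>\<^bsub>T\<^esub> word (TL_augmentation y) []"
    using add by (simp add: word_Nil_add)
  ultimately have "(\<Oplus>\<^bsub>T\<^esub>s\<in>{1..<n}. pr s (x \<oplus>\<^bsub>T\<^esub> y)) \<oplus>\<^bsub>T\<^esub> word (TL_augmentation (x \<oplus>\<^bsub>T\<^esub> y)) [] =
     ((\<Oplus>\<^bsub>T\<^esub>s\<in>{1..<n}. pr s x) \<oplus>\<^bsub>T\<^esub> word (TL_augmentation x) []) \<oplus>\<^bsub>T\<^esub>
     ((\<Oplus>\<^bsub>T\<^esub>s\<in>{1..<n}. pr s y) \<oplus>\<^bsub>T\<^esub> word (TL_augmentation y) [])"
    using add.hyps by (simp add: T.a_ac word_closed T.finsum_closed)
  then show ?case using add.IH by simp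
next
  case (word r w)
  show ?case
  proof (cases "w = []")
    case True
    then have "pr s (word r w) = \<zero>\<^bsub>T\<^esub>" for s
      using word by (simp add: pr_word first_cup_def cups_Nil)
    then show ?thesis using True word by (simp add: augmentation_word T.finsum_zero word_closed)
  next
    case False
    then obtain v i where "w = v @ [i]" by (meson rev_exhaust)
    then have ne: "cups w \<noteq> {}" using cups_snoc by blast
    have sub: "cups w \<subseteq> {1..<n}" using cups_subset_set[of w] word by blast
    then have fin: "finite (cups w)" using finite_subset by blast
    define m where "m = Min (cups w)"
    have m: "m \<in> {1..<n}" "first_cup s w \<longleftrightarrow> m = s" for s
      using Min_in[OF fin ne] Min_le[OF fin] sub
      unfolding first_cup_def m_def by (auto intro: antisym)
    have "(\<Oplus>\<^bsub>T\<^esub>s\<in>{1..<n}. pr s (word r w)) = (\<Oplus>\<^bsub>T\<^esub>s\<in>{1..<n}. if m = s then word r w else \<zero>\<^bsub>T\<^esub>)"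
      using word by (simp add: pr_word m(2))
    also have "\<dots> = word r w"
      using word m(1) by (intro T.finsum_singleton) (auto simp: word_closed)
    finally have "(\<Oplus>\<^bsub>T\<^esub>s\<in>{1..<n}. pr s (word r w)) = word r w" .
    moreover have "monomial R \<zero> [] = \<zero>\<^bsub>A\<^esub>" by (auto simp: monomial_def free_algebra_def)
    ultimately show ?thesis using word False
      by (simp add: augmentation_word word_closed) (simp add: word_def monomial_closed)
  qed
qed

lemma augmentation_Cup:
  assumes "x \<in> cup F" "innermost n F" "F \<noteq> {}"
  shows "TL_augmentation x = \<zero>"
  using assms(1,2)
proof (induction rule: Cup_induct)
  case (add x y)
  have F: "F \<subseteq> {1..<n}" using assms by (simp add: innermost_def)
  from add show ?case using Cup_closed(1)[OF F] by simp
next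
  case (word r w)
  then show ?case using assms(3) by (auto simp: augmentation_word cups_Nil)
qed simp

lemma sum_pr_Cup:
  assumes "x \<in> cup F" "innermost n F" "F \<noteq> {}"
  shows "(\<Oplus>\<^bsub>T\<^esub>s\<in>{1..<n}. pr s x) = x"
proof -
  have F: "F \<subseteq> {1..<n}" using assms by (simp add: innermost_def)
  have "TL_augmentation x = \<zero>" by (rule augmentation_Cup[OF assms])
  moreover have "monomial R \<zero> [] = \<zero>\<^bsub>A\<^esub>" by (auto simp: monomial_def free_algebra_def)
  ultimately show ?thesis using sum_pr[OF Cup_closed(1)[OF F assms(1)]] Cup_closed(1)[OF F assms(1)]
    by (simp add: word_def T.finsum_closed)
qed

end

section \<open>The cellular Davis complex\<close>

lemma card_below_insert:
  "finite G \<Longrightarrow> s \<notin> G \<Longrightarrow> card {u \<in> insert s G. u < t} = card {u \<in> G. u < t} + (if s < t then 1 else 0)"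
  for s t :: nat
proof -
  assume "finite G" "s \<notin> G"
  moreover have "{u \<in> insert s G. u < t} = (if s < t then insert s {u \<in> G. u < t} else {u \<in> G. u < t})"
    by auto
  ultimately show ?thesis by simp
qed

lemma Davis_indexD:
  assumes "F \<in> Davis_index n \<alpha>"
  shows "innermost n F" "finite F" "F \<subseteq> {1..<n}" "int (card F) = \<alpha>"
  using assms finite_innermost by (auto simp: Davis_index_def innermost_def)

lemma Davis_index_insert:
  "G \<in> Davis_index n \<alpha> \<Longrightarrow> s \<notin> G \<Longrightarrow> innermost n (insert s G) \<Longrightarrow> insert s G \<in> Davis_index n (\<alpha> + 1)"
  using Davis_indexD(2)[of G] by (auto simp: Davis_index_def)

lemma Davis_index_remove:
  "F \<in> Davis_index n \<alpha> \<Longrightarrow> s \<in> F \<Longrightarrow> F - {s} \<in> Davis_index n (\<alpha> - 1)"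
proof -
  assume F: "F \<in> Davis_index n \<alpha>" "s \<in> F"
  note Fd = Davis_indexD[OF F(1)]
  have "card F = Suc (card (F - {s}))" using card.remove[OF Fd(2) F(2)] .
  then show ?thesis
    using Fd(4) innermost_subset[OF Fd(1), of "F - {s}"] by (simp add: Davis_index_def)
qed

lemma finite_Davis_index: "finite (Davis_index n \<alpha>)"
  by (rule finite_subset[of _ "Pow {1..<n}"]) (auto dest: Davis_indexD)

context temperley_lieb
begin

section \<open>The differential in coordinates\<close>

abbreviation "D \<equiv> Davis R n a"
abbreviation "\<delta> \<equiv> Davis_diff R n a"

definition signed :: "nat \<Rightarrow> (nat list \<Rightarrow> 'a) set \<Rightarrow> (nat list \<Rightarrow> 'a) set"
  where "signed k x = (if even k then x else \<ominus>\<^bsub>T\<^esub> x)"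

lemma signed_closed: "x \<in> carrier T \<Longrightarrow> signed k x \<in> carrier T"
  by (simp add: signed_def)

text \<open>The share of the summand \<open>insert s G\<close> in the component of the differential
  at \<open>G\<close>. Since \<open>s\<close> is not below itself, counting in \<open>G\<close>
  gives the same sign as counting in \<open>insert s G\<close>. The default zero lets all sums run
  over \<open>{1..<n}\<close>, independently of \<open>G\<close>.\<close>

definition diff_term :: "(nat set \<Rightarrow> (nat list \<Rightarrow> 'a) set) \<Rightarrow> nat set \<Rightarrow> nat \<Rightarrow> (nat list \<Rightarrow> 'a) set"
  where "diff_term x G s = (if s \<notin> G \<and> innermost n (insert s G)
    then signed (card {t \<in> G. t < s}) (x (insert s G)) else \<zero>\<^bsub>T\<^esub>)"

lemma Davis_left_module: "left_module T (D \<alpha>)"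
  unfolding Davis_def by (intro left_module_direct_sum T.ring_axioms Cup_left_module Davis_indexD(3))

sublocale D: left_module T "D \<alpha>" for \<alpha>
  by (rule Davis_left_module)

lemma Davis_carrier: "carrier (D \<alpha>) = (\<Pi>\<^sub>E F\<in>Davis_index n \<alpha>. cup F)"
  by (auto simp: Davis_def direct_sum_module_def finite_Davis_index)

lemma Davis_apply:
  assumes "F \<in> Davis_index n \<alpha>"
  shows "(x \<oplus>\<^bsub>D \<alpha>\<^esub> y) F = x F \<oplus>\<^bsub>T\<^esub> y F" "(t \<odot>\<^bsub>D \<alpha>\<^esub> x) F = t \<otimes>\<^bsub>T\<^esub> x F" "\<zero>\<^bsub>D \<alpha>\<^esub> F = \<zero>\<^bsub>T\<^esub>"
  using assms by (simp_all add: Davis_def direct_sum_module_def Cup_simps)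

lemma Davis_ext:
  "x \<in> carrier (D \<alpha>) \<Longrightarrow> y \<in> carrier (D \<alpha>) \<Longrightarrow> (\<And>F. F \<in> Davis_index n \<alpha> \<Longrightarrow> x F = y F) \<Longrightarrow> x = y"
  unfolding Davis_carrier by (rule PiE_ext)

lemma Davis_cup: "x \<in> carrier (D \<alpha>) \<Longrightarrow> F \<in> Davis_index n \<alpha> \<Longrightarrow> x F \<in> cup F"
  unfolding Davis_carrier by auto

lemma Davis_closed: "x \<in> carrier (D \<alpha>) \<Longrightarrow> F \<in> Davis_index n \<alpha> \<Longrightarrow> x F \<in> carrier T"
  using Davis_cup Cup_closed(1) Davis_indexD(3) by blast

lemma Davis_eval_hom:
  assumes "F \<in> Davis_index n \<alpha>"
  shows "abelian_group_hom (D \<alpha>) T (\<lambda>x. x F)"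
  using assms
  by (intro abelian_group_homI group_hom.intro group_hom_axioms.intro homI D.a_group T.a_group
      T.abelian_group_axioms D.M.abelian_group_axioms) (simp_all add: Davis_apply Davis_closed)

lemma diff_term_closed:
  "x \<in> carrier (D \<alpha>) \<Longrightarrow> G \<in> Davis_index n (\<alpha> - 1) \<Longrightarrow> diff_term x G s \<in> carrier T"
  using Davis_index_insert[of G n "\<alpha> - 1" s]
  by (auto simp: diff_term_def intro: signed_closed Davis_closed)

lemma Davis_diff_summand:
  assumes x: "x \<in> carrier (D \<alpha>)" and F: "F \<in> Davis_index n \<alpha>" "s \<in> F"
  defines "y \<equiv> \<lambda>k. add_pow (D (\<alpha> - 1)) ((- 1 :: int) ^ k)
      (direct_sum_inj (Davis_index n (\<alpha> - 1)) (Cup R n a) (F - {s}) (x F))"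
  shows "y k \<in> carrier (D (\<alpha> - 1))"
    and "G \<in> Davis_index n (\<alpha> - 1) \<Longrightarrow> y k G = (if G = F - {s} then signed k (x F) else \<zero>\<^bsub>T\<^esub>)"
proof -
  let ?i = "direct_sum_inj (Davis_index n (\<alpha> - 1)) (Cup R n a) (F - {s}) (x F)"
  have cup: "x F \<in> cup (F - {s})"
    using Cup_mono[of "F - {s}" F] Davis_indexD(1)[OF F(1)] Davis_cup[OF x F(1)] by blast
  have i: "?i \<in> carrier (D (\<alpha> - 1))"
    unfolding Davis_carrier direct_sum_inj_def using cup Cup_closed(2)[OF Davis_indexD(3)]
    by (auto simp: Cup_simps)
  then show "y k \<in> carrier (D (\<alpha> - 1))" unfolding y_def by (simp add: D.M.add_pow_sign)
  assume G: "G \<in> Davis_index n (\<alpha> - 1)"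
  interpret ev: abelian_group_hom "D (\<alpha> - 1)" T "\<lambda>x. x G" by (rule Davis_eval_hom[OF G])
  have iG: "?i G = (if G = F - {s} then x F else \<zero>\<^bsub>T\<^esub>)"
    using G by (simp add: direct_sum_inj_def Cup_simps)
  have "y k G = signed k (?i G)"
    unfolding y_def D.M.add_pow_sign[OF i] by (simp add: signed_def ev.hom_a_inv[OF i])
  then show "y k G = (if G = F - {s} then signed k (x F) else \<zero>\<^bsub>T\<^esub>)"
    unfolding iG by (simp add: signed_def)
qed

lemma Davis_diff_closed: "x \<in> carrier (D \<alpha>) \<Longrightarrow> \<delta> \<alpha> x \<in> carrier (D (\<alpha> - 1))"
  unfolding Davis_diff_def by (intro D.M.finsum_closed Pi_I Davis_diff_summand(1))

text \<open>The double sum over F and s in F is evaluated at one component \<open>G\<close>. Only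
  sets F of the form \<open>insert s G\<close> have \<open>G\<close> as a face, and in such a
  summand only the removal of that \<open>s\<close> yields \<open>G\<close>.\<close>

lemma Davis_diff_apply:
  assumes x: "x \<in> carrier (D \<alpha>)" and G: "G \<in> Davis_index n (\<alpha> - 1)"
  shows "\<delta> \<alpha> x G = (\<Oplus>\<^bsub>T\<^esub>s\<in>{1..<n}. diff_term x G s)"
proof -
  interpret ev: abelian_group_hom "D (\<alpha> - 1)" T "\<lambda>x. x G" by (rule Davis_eval_hom[OF G])
  define v where "v F s = (if G = F - {s} then signed (card {t \<in> F. t < s}) (x F) else \<zero>\<^bsub>T\<^esub>)" for F s
  define S where "S = {s \<in> {1..<n}. s \<notin> G \<and> innermost n (insert s G)}"
  have v: "v F s \<in> carrier T" if "F \<in> Davis_index n \<alpha>" for F s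
    using that Davis_closed[OF x] by (simp add: v_def signed_closed)
  have "\<delta> \<alpha> x G = (\<Oplus>\<^bsub>T\<^esub>F\<in>Davis_index n \<alpha>. \<Oplus>\<^bsub>T\<^esub>s\<in>F. v F s)"
  proof -
    have "\<delta> \<alpha> x G = (\<Oplus>\<^bsub>T\<^esub>F\<in>Davis_index n \<alpha>. (\<Oplus>\<^bsub>D (\<alpha> - 1)\<^esub>s\<in>F.
       add_pow (D (\<alpha> - 1)) ((- 1 :: int) ^ card {s'\<in>F. s' < s})
         (direct_sum_inj (Davis_index n (\<alpha> - 1)) (Cup R n a) (F - {s}) (x F))) G)"
      unfolding Davis_diff_def
      by (rule ev.hom_finsum) (intro D.M.finsum_closed Pi_I Davis_diff_summand(1)[OF x])
    also have "\<dots> = (\<Oplus>\<^bsub>T\<^esub>F\<in>Davis_index n \<alpha>. \<Oplus>\<^bsub>T\<^esub>s\<in>F. v F s)"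
    proof (rule T.finsum_cong')
      fix F assume F: "F \<in> Davis_index n \<alpha>"
      let ?y = "\<lambda>s. add_pow (D (\<alpha> - 1)) ((- 1 :: int) ^ card {s'\<in>F. s' < s})
         (direct_sum_inj (Davis_index n (\<alpha> - 1)) (Cup R n a) (F - {s}) (x F))"
      have "(\<Oplus>\<^bsub>D (\<alpha> - 1)\<^esub>s\<in>F. ?y s) G = (\<Oplus>\<^bsub>T\<^esub>s\<in>F. ?y s G)"
        by (rule ev.hom_finsum) (intro Pi_I Davis_diff_summand(1)[OF x F])
      also have "\<dots> = (\<Oplus>\<^bsub>T\<^esub>s\<in>F. v F s)"
      proof (rule T.finsum_cong')
        show "?y s G = v F s" if "s \<in> F" for s
          unfolding v_def by (rule Davis_diff_summand(2)[OF x F that G])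
      qed (simp_all add: v[OF F])
      finally show "(\<Oplus>\<^bsub>D (\<alpha> - 1)\<^esub>s\<in>F. ?y s) G = (\<Oplus>\<^bsub>T\<^esub>s\<in>F. v F s)" .
    qed (simp_all add: Pi_iff T.finsum_closed v)
    finally show ?thesis .
  qed
  also have "\<dots> = (\<Oplus>\<^bsub>T\<^esub>F\<in>(\<lambda>s. insert s G) ` S. \<Oplus>\<^bsub>T\<^esub>s\<in>F. v F s)"
  proof (rule T.add.finprod_mono_neutral_cong_right[OF finite_Davis_index])
    show "(\<lambda>s. insert s G) ` S \<subseteq> Davis_index n \<alpha>"
      using Davis_index_insert[OF G] by (auto simp: S_def)
    show "(\<Oplus>\<^bsub>T\<^esub>s\<in>F. v F s) = \<zero>\<^bsub>T\<^esub>" if F: "F \<in> Davis_index n \<alpha> - (\<lambda>s. insert s G) ` S" for F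
    proof (rule T.add.finprod_one_eqI)
      fix s assume s: "s \<in> F"
      have "F \<noteq> insert s G" if "s \<notin> G"
        using F s that Davis_indexD[of F n \<alpha>] by (auto simp: S_def)
      then have "G \<noteq> F - {s}" using s by auto
      then show "v F s = \<zero>\<^bsub>T\<^esub>" by (simp add: v_def)
    qed
  qed (simp_all add: Pi_iff T.finsum_closed v)
  also have "\<dots> = (\<Oplus>\<^bsub>T\<^esub>s\<in>S. \<Oplus>\<^bsub>T\<^esub>t\<in>insert s G. v (insert s G) t)"
    using Davis_index_insert[OF G]
    by (intro T.finsum_reindex) (auto simp: S_def inj_on_def intro!: T.finsum_closed v)
  also have "\<dots> = (\<Oplus>\<^bsub>T\<^esub>s\<in>{1..<n}. diff_term x G s)"
  proof (rule T.add.finprod_mono_neutral_cong_left)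
    show "diff_term x G \<in> {1..<n} \<rightarrow> carrier T" by (intro Pi_I diff_term_closed[OF x G])
    fix s assume s: "s \<in> S"
    then have F: "insert s G \<in> Davis_index n \<alpha>" using Davis_index_insert[OF G] by (auto simp: S_def)
    have eq: "G = insert s G - {t} \<longleftrightarrow> s = t" if "t \<in> insert s G" for t
      using s that by (auto simp: S_def)
    have "(\<Oplus>\<^bsub>T\<^esub>t\<in>insert s G. v (insert s G) t) =
       (\<Oplus>\<^bsub>T\<^esub>t\<in>insert s G. if s = t then v (insert s G) t else \<zero>\<^bsub>T\<^esub>)"
    proof (rule T.finsum_cong')
      show "v (insert s G) t = (if s = t then v (insert s G) t else \<zero>\<^bsub>T\<^esub>)" if "t \<in> insert s G" for t
        unfolding v_def eq[OF that] by simp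
    qed (simp_all add: Pi_iff v[OF F])
    also have "\<dots> = v (insert s G) s"
      using Davis_indexD(2)[OF G] by (intro T.finsum_singleton) (simp_all add: v[OF F])
    also have "\<dots> = diff_term x G s"
    proof -
      have "v (insert s G) s = signed (card {t \<in> insert s G. t < s}) (x (insert s G))"
        unfolding v_def by (rule if_P) (use eq[of s] in blast)
      then show ?thesis
        using s by (simp add: diff_term_def S_def card_below_insert[OF Davis_indexD(2)[OF G]] del: insert_iff)
    qed
    finally show "(\<Oplus>\<^bsub>T\<^esub>t\<in>insert s G. v (insert s G) t) = diff_term x G s" .
  qed (auto simp: S_def diff_term_def)
  finally show ?thesis .
qed

lemma Davis_diff_hom: "\<delta> \<alpha> \<in> left_module_hom T (D \<alpha>) (D (\<alpha> - 1))"
proof -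
  have add: "\<delta> \<alpha> (x \<oplus>\<^bsub>D \<alpha>\<^esub> y) = \<delta> \<alpha> x \<oplus>\<^bsub>D (\<alpha> - 1)\<^esub> \<delta> \<alpha> y"
    if x: "x \<in> carrier (D \<alpha>)" and y: "y \<in> carrier (D \<alpha>)" for x y
  proof (rule Davis_ext)
    fix G assume G: "G \<in> Davis_index n (\<alpha> - 1)"
    have "diff_term (x \<oplus>\<^bsub>D \<alpha>\<^esub> y) G s = diff_term x G s \<oplus>\<^bsub>T\<^esub> diff_term y G s" for s
      using Davis_index_insert[OF G, of s] Davis_closed[OF x] Davis_closed[OF y]
      by (auto simp: diff_term_def signed_def Davis_apply T.minus_add)
    then show "\<delta> \<alpha> (x \<oplus>\<^bsub>D \<alpha>\<^esub> y) G = (\<delta> \<alpha> x \<oplus>\<^bsub>D (\<alpha> - 1)\<^esub> \<delta> \<alpha> y) G"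
      using x y G diff_term_closed[OF x G] diff_term_closed[OF y G]
      by (simp add: Davis_diff_apply Davis_apply T.finsum_addf)
  qed (use x y Davis_diff_closed in auto)
  have smult: "\<delta> \<alpha> (t \<odot>\<^bsub>D \<alpha>\<^esub> x) = t \<odot>\<^bsub>D (\<alpha> - 1)\<^esub> \<delta> \<alpha> x"
    if t: "t \<in> carrier T" and x: "x \<in> carrier (D \<alpha>)" for t x
  proof (rule Davis_ext)
    fix G assume G: "G \<in> Davis_index n (\<alpha> - 1)"
    have "diff_term (t \<odot>\<^bsub>D \<alpha>\<^esub> x) G s = t \<otimes>\<^bsub>T\<^esub> diff_term x G s" for s
      using Davis_index_insert[OF G, of s] Davis_closed[OF x] t
      by (auto simp: diff_term_def signed_def Davis_apply T.r_minus)
    then show "\<delta> \<alpha> (t \<odot>\<^bsub>D \<alpha>\<^esub> x) G = (t \<odot>\<^bsub>D (\<alpha> - 1)\<^esub> \<delta> \<alpha> x) G"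
      using x t G diff_term_closed[OF x G]
      by (simp add: Davis_diff_apply Davis_apply T.finsum_rdistr)
  qed (use x t Davis_diff_closed in auto)
  show ?thesis
    unfolding left_module_hom_def using add smult Davis_diff_closed by auto
qed

lemma Davis_diff_diff:
  assumes x: "x \<in> carrier (D \<alpha>)"
  shows "\<delta> (\<alpha> - 1) (\<delta> \<alpha> x) = \<zero>\<^bsub>D (\<alpha> - 1 - 1)\<^esub>"
proof (rule Davis_ext)
  fix G assume G: "G \<in> Davis_index n (\<alpha> - 1 - 1)"
  note fin = Davis_indexD(2)[OF G]
  let ?c = "\<lambda>G s. card {t \<in> G. t < s}"
  \<comment> \<open>\<open>b s t\<close> is the term of the double differential that joins
    \<open>s\<close> to \<open>G\<close> first and then \<open>t\<close>; swapping them must flip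
    the sign.\<close>
  define b where "b s t = (if s \<notin> G \<and> t \<notin> G \<and> s \<noteq> t \<and> innermost n (insert t (insert s G))
     then signed (?c G s + ?c (insert s G) t) (x (insert t (insert s G))) else \<zero>\<^bsub>T\<^esub>)" for s t
  have idx: "insert t (insert s G) \<in> Davis_index n \<alpha>"
    if "s \<notin> G" "t \<notin> G" "s \<noteq> t" "innermost n (insert t (insert s G))" for s t
    using Davis_index_insert[OF Davis_index_insert[OF G that(1)], of t] that
      innermost_subset[OF that(4), of "insert s G"] by auto
  have bc: "b s t \<in> carrier T" for s t
    using idx Davis_closed[OF x] by (simp add: b_def signed_closed)
  have "diff_term (\<delta> \<alpha> x) G s = (\<Oplus>\<^bsub>T\<^esub>t\<in>{1..<n}. b s t)" for s
  proof (cases "s \<notin> G \<and> innermost n (insert s G)")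
    case True
    then have sG: "insert s G \<in> Davis_index n (\<alpha> - 1)" using Davis_index_insert[OF G] by simp
    have d: "diff_term x (insert s G) t \<in> carrier T" for t using diff_term_closed[OF x sG] .
    have bd: "b s t = signed (?c G s) (diff_term x (insert s G) t)" for t
      using True idx[of s t] Davis_closed[OF x]
      by (auto simp: b_def diff_term_def signed_def)
    have "diff_term (\<delta> \<alpha> x) G s = signed (?c G s) (\<Oplus>\<^bsub>T\<^esub>t\<in>{1..<n}. diff_term x (insert s G) t)"
      using True by (simp add: diff_term_def[of "\<delta> \<alpha> x"] Davis_diff_apply[OF x sG])
    also have "\<dots> = (\<Oplus>\<^bsub>T\<^esub>t\<in>{1..<n}. b s t)"
      using d T.finsum_neg[of "diff_term x (insert s G)" "{1..<n}"] by (simp add: bd signed_def)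
    finally show ?thesis .
  next
    case False
    then have "b s t = \<zero>\<^bsub>T\<^esub>" for t
      using innermost_subset[of n "insert t (insert s G)" "insert s G"] by (auto simp: b_def)
    moreover have "diff_term (\<delta> \<alpha> x) G s = \<zero>\<^bsub>T\<^esub>"
      unfolding diff_term_def by (rule if_not_P[OF False])
    ultimately show ?thesis by (simp add: T.finsum_zero)
  qed
  then have "\<delta> (\<alpha> - 1) (\<delta> \<alpha> x) G = (\<Oplus>\<^bsub>T\<^esub>s\<in>{1..<n}. \<Oplus>\<^bsub>T\<^esub>t\<in>{1..<n}. b s t)"
    using G by (simp add: Davis_diff_apply[OF Davis_diff_closed[OF x]])
  also have "\<dots> = \<zero>\<^bsub>T\<^esub>"
  proof (rule T.finsum_alternating)
    show "b s s = \<zero>\<^bsub>T\<^esub>" for s by (simp add: b_def)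
    fix s t :: nat
    assume st: "s \<noteq> t"
    show "b s t = \<ominus>\<^bsub>T\<^esub> b t s"
    proof (cases "s \<notin> G \<and> t \<notin> G \<and> innermost n (insert t (insert s G))")
      case True
      define y where "y = x (insert t (insert s G))"
      have y: "y \<in> carrier T" using True st idx Davis_closed[OF x] by (simp add: y_def)
      have "b s t = signed (?c G s + ?c (insert s G) t) y" "b t s = signed (?c G t + ?c (insert t G) s) y"
        using True st by (simp_all add: b_def y_def insert_commute)
      \<comment> \<open>Exactly one of the two counts grows by 1, so the two exponents have opposite
        parity.\<close>
      moreover have "?c (insert s G) t = ?c G t + (if s < t then 1 else 0)"
        "?c (insert t G) s = ?c G s + (if t < s then 1 else 0)"
        using True fin by (simp_all add: card_below_insert del: insert_iff)
      ultimately show ?thesis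
        using y st by (simp add: signed_def del: insert_iff)
    next
      case False
      then have "b s t = \<zero>\<^bsub>T\<^esub>" "b t s = \<zero>\<^bsub>T\<^esub>"
        unfolding b_def by (simp_all only: insert_commute) (rule if_not_P, blast)+
      then show ?thesis by simp
    qed
  qed (simp_all add: bc)
  finally show "\<delta> (\<alpha> - 1) (\<delta> \<alpha> x) G = \<zero>\<^bsub>D (\<alpha> - 1 - 1)\<^esub> G" using G by (simp add: Davis_apply)
qed (simp_all only: Davis_diff_closed[OF Davis_diff_closed[OF x]] D.M.zero_closed)


text \<open>The cone on the least cup inserts s into the index of the piece graded by s. Read at the
  component F, the inserted element is \<open>Min F\<close>, so only that piece of
  \<open>x (F - {Min F})\<close> contributes; the sign is + because nothing in F precedes its
  minimum.\<close>

definition homotopy :: "int \<Rightarrow> (nat set \<Rightarrow> (nat list \<Rightarrow> 'a) set) \<Rightarrow> nat set \<Rightarrow> (nat list \<Rightarrow> 'a) set"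
  where "homotopy \<alpha> x = (\<lambda>F\<in>Davis_index n (\<alpha> + 1). pr (Min F) (x (F - {Min F})))"

lemma homotopy_closed:
  assumes "x \<in> carrier (D \<alpha>)" "\<alpha> \<ge> 0"
  shows "homotopy \<alpha> x \<in> carrier (D (\<alpha> + 1))"
  unfolding Davis_carrier homotopy_def
proof (rule restrict_PiE_iff[THEN iffD2], rule ballI)
  fix F assume F: "F \<in> Davis_index n (\<alpha> + 1)"
  note Fd = Davis_indexD[OF F]
  \<comment> \<open>This is where \<open>\<alpha> \<ge> 0\<close> is needed: \<open>Min F\<close>
    must be an element of F.\<close>
  have "F \<noteq> {}" using Fd(4) assms(2) by auto
  then have m: "Min F \<in> F" using Fd(2) by simp
  have G: "F - {Min F} \<in> Davis_index n \<alpha>" using Davis_index_remove[OF F m] by simp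
  have "pr (Min F) (x (F - {Min F})) \<in> cup (insert (Min F) (F - {Min F}))"
    using Davis_indexD(1)[OF G] m Fd(3) by (intro pr_Cup Davis_cup[OF assms(1) G]) auto
  then show "pr (Min F) (x (F - {Min F})) \<in> cup F" using m by (simp add: insert_absorb)
qed

lemma cycle_is_boundary:
  assumes x: "x \<in> carrier (D \<alpha>)" and \<alpha>: "\<alpha> > 0" and cycle: "\<delta> \<alpha> x = \<zero>\<^bsub>D (\<alpha> - 1)\<^esub>"
  shows "\<delta> (\<alpha> + 1) (homotopy \<alpha> x) = x"
proof (rule Davis_ext)
  have h: "homotopy \<alpha> x \<in> carrier (D (\<alpha> + 1))" using homotopy_closed x \<alpha> by simp
  then show "\<delta> (\<alpha> + 1) (homotopy \<alpha> x) \<in> carrier (D \<alpha>)" using Davis_diff_closed by fastforce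
  fix G assume G: "G \<in> Davis_index n \<alpha>"
  note Gd = Davis_indexD[OF G]
  have G': "G \<in> Davis_index n (\<alpha> + 1 - 1)" using G by simp
  have ne: "G \<noteq> {}" using Gd(4) \<alpha> by auto
  define m where "m = Min G"
  have m: "m \<in> G" "\<And>t. t \<in> G \<Longrightarrow> m \<le> t" using Gd(2) ne by (auto simp: m_def)
  define H where "H = G - {m}"
  have H: "H \<in> Davis_index n (\<alpha> - 1)" using Davis_index_remove[OF G m(1)] by (simp add: H_def)
  note Hd = Davis_indexD[OF H]
  have GH: "G = insert m H" "m \<notin> H" using m(1) by (auto simp: H_def)
  have xG: "x G \<in> cup G" using x G by (rule Davis_cup)
  have u: "diff_term (homotopy \<alpha> x) G s \<in> carrier T" for s using diff_term_closed[OF h G'] .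
  have v: "diff_term x H s \<in> carrier T" for s using diff_term_closed[OF x H] .
  \<comment> \<open>The sum is the component at \<open>G\<close> of the homotopy applied to
    \<open>\<delta> \<alpha> x\<close>, which is zero for a cycle.\<close>
  have v0: "(\<Oplus>\<^bsub>T\<^esub>s\<in>{1..<n}. pr m (diff_term x H s)) = \<zero>\<^bsub>T\<^esub>"
  proof -
    have "(\<Oplus>\<^bsub>T\<^esub>s\<in>{1..<n}. pr m (diff_term x H s)) = pr m (\<delta> \<alpha> x H)"
      unfolding Davis_diff_apply[OF x H] by (rule pr.hom_finsum[symmetric]) (simp add: v)
    then show ?thesis using H by (simp add: cycle Davis_apply)
  qed
  \<comment> \<open>\<open>\<delta> h + h \<delta> = id\<close> holds summand by summand.\<close>
  have eq: "diff_term (homotopy \<alpha> x) G s \<oplus>\<^bsub>T\<^esub> pr m (diff_term x H s) = pr s (x G)"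
    if s: "s \<in> {1..<n}" for s
  proof -
    consider "s < m" | "s = m" | "m < s" "s \<in> G" | "m < s" "s \<notin> G" by linarith
    then show ?thesis
    proof cases
      \<comment> \<open>Here \<open>s\<close> becomes the new minimum, so the first term is already
        the right-hand side. The second term comes from a summand whose index contains
        \<open>s < m\<close>, which \<open>pr m\<close> kills.\<close>
      case 1
      then have sG: "s \<notin> G" using m(2) by force
      have "\<not> t < s" if "t \<in> G" for t using m(2)[OF that] 1 by simp
      then have "{t \<in> G. t < s} = {}" by blast
      then have c: "card {t \<in> G. t < s} = 0" by simp
      have "diff_term (homotopy \<alpha> x) G s = pr s (x G)"
      proof (cases "innermost n (insert s G)")
        case True
        have "insert s G \<in> Davis_index n (\<alpha> + 1)" using Davis_index_insert[OF G sG True] .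
        moreover have "Min (insert s G) = s" using 1 m(2) Gd(2) by (intro Min_eqI) force+
        ultimately show ?thesis using True sG by (simp add: diff_term_def homotopy_def signed_def c)
      next
        case False
        then have "pr s (x G) = \<zero>\<^bsub>T\<^esub>" by (intro pr_zero[OF xG Gd(1)]) simp
        then show ?thesis using False by (simp add: diff_term_def)
      qed
      moreover have "pr m (diff_term x H s) = \<zero>\<^bsub>T\<^esub>"
      proof (cases "s \<notin> H \<and> innermost n (insert s H)")
        case True
        then have i: "insert s H \<in> Davis_index n \<alpha>" using Davis_index_insert[OF H] by simp
        have "pr m (x (insert s H)) = \<zero>\<^bsub>T\<^esub>"
          using 1 True by (intro pr_zero[OF Davis_cup[OF x i]]) auto
        then show ?thesis using True Davis_closed[OF x i] by (simp add: diff_term_def signed_def)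
      next
        case False
        show ?thesis unfolding diff_term_def if_not_P[OF False] by simp
      qed
      moreover have "pr s (x G) \<in> carrier T" using Davis_closed[OF x G] by simp
      ultimately show ?thesis by simp
    next
      \<comment> \<open>The roles are exchanged: \<open>m\<close> cannot be inserted into
        \<open>G\<close>, and inserting it into \<open>H\<close> gives back
        \<open>G\<close>.\<close>
      case 2
      have "{t \<in> H. t < m} = {}" using m(2) by (auto simp: H_def dest: leD)
      then have c: "card {t \<in> H. t < m} = 0" by simp
      have "diff_term x H m = x G"
        using Gd(1) GH(2) unfolding diff_term_def c GH(1)[symmetric] by (simp add: signed_def)
      moreover have "diff_term (homotopy \<alpha> x) G m = \<zero>\<^bsub>T\<^esub>" using m(1) by (simp add: diff_term_def)
      ultimately show ?thesis using 2 Davis_closed[OF x G] by simp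
    next
      case 3
      then have "s \<in> H" by (simp add: H_def)
      moreover have "pr s (x G) = \<zero>\<^bsub>T\<^esub>" using 3 m(1) by (intro pr_zero[OF xG Gd(1)]) auto
      ultimately show ?thesis using 3 by (simp add: diff_term_def)
    next
      \<comment> \<open>The minimum stays \<open>m\<close>, so both terms involve
        \<open>pr m (x (insert s H))\<close>. Their signs are opposite because \<open>m\<close> lies
        below \<open>s\<close> and is counted in \<open>G\<close> but not in
        \<open>H\<close>.\<close>
      case 4
      then have sH: "s \<notin> H" by (simp add: H_def)
      have z: "pr s (x G) = \<zero>\<^bsub>T\<^esub>" using 4 m(1) by (intro pr_zero[OF xG Gd(1)]) auto
      have c: "card {t \<in> G. t < s} = card {t \<in> H. t < s} + 1"
        using card_below_insert[OF Hd(2) GH(2), of s] 4(1) by (simp add: GH(1) del: insert_iff)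
      show ?thesis
      proof (cases "innermost n (insert s G)")
        case True
        then have i: "insert s H \<in> Davis_index n \<alpha>" and j: "insert s G \<in> Davis_index n (\<alpha> + 1)"
          using Davis_index_insert[OF H sH] Davis_index_insert[OF G 4(2)]
            innermost_subset[OF True, of "insert s H"] by (auto simp: H_def)
        have "Min (insert s G) = m" using 4 m Gd(2) by (intro Min_eqI) force+
        moreover have "insert s G - {m} = insert s H" using 4 by (auto simp: H_def)
        ultimately have "homotopy \<alpha> x (insert s G) = pr m (x (insert s H))"
          using j by (simp add: homotopy_def)
        then have "diff_term (homotopy \<alpha> x) G s = signed (card {t \<in> H. t < s} + 1) (pr m (x (insert s H)))"
          using True 4 by (simp add: diff_term_def c)
        moreover have "diff_term x H s = signed (card {t \<in> H. t < s}) (x (insert s H))"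
          using Davis_indexD(1)[OF i] sH by (simp add: diff_term_def)
        ultimately show ?thesis
          using Davis_closed[OF x i] z by (simp add: signed_def T.l_neg T.r_neg)
      next
        case False
        \<comment> \<open>Possibly \<open>insert s H\<close> is innermost although
          \<open>insert s G\<close> is not; then no word has cups at all of
          \<open>insert m (insert s H)\<close>, and \<open>pr m\<close> gives zero.\<close>
        have "pr m (diff_term x H s) = \<zero>\<^bsub>T\<^esub>"
        proof (cases "innermost n (insert s H)")
          case True
          then have i: "insert s H \<in> Davis_index n \<alpha>" using Davis_index_insert[OF H sH] by simp
          have "pr m (x (insert s H)) = \<zero>\<^bsub>T\<^esub>"
            using False by (intro pr_zero[OF Davis_cup[OF x i] True]) (simp add: GH(1) insert_commute)
          then show ?thesis using True sH Davis_closed[OF x i] by (simp add: diff_term_def signed_def)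
        qed (simp add: diff_term_def)
        then show ?thesis using False z by (simp add: diff_term_def)
      qed
    qed
  qed
  have "\<delta> (\<alpha> + 1) (homotopy \<alpha> x) G = (\<Oplus>\<^bsub>T\<^esub>s\<in>{1..<n}. diff_term (homotopy \<alpha> x) G s)"
    by (rule Davis_diff_apply[OF h G'])
  also have "\<dots> = (\<Oplus>\<^bsub>T\<^esub>s\<in>{1..<n}. diff_term (homotopy \<alpha> x) G s) \<oplus>\<^bsub>T\<^esub>
      (\<Oplus>\<^bsub>T\<^esub>s\<in>{1..<n}. pr m (diff_term x H s))"
    unfolding v0 by (simp add: u T.finsum_closed)
  also have "\<dots> = (\<Oplus>\<^bsub>T\<^esub>s\<in>{1..<n}. diff_term (homotopy \<alpha> x) G s \<oplus>\<^bsub>T\<^esub> pr m (diff_term x H s))"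
    by (rule T.finsum_addf[symmetric]) (simp_all add: u v)
  also have "\<dots> = (\<Oplus>\<^bsub>T\<^esub>s\<in>{1..<n}. pr s (x G))"
    by (rule T.finsum_cong') (simp_all add: eq Davis_closed[OF x G])
  also have "\<dots> = x G" by (rule sum_pr_Cup[OF xG Gd(1) ne])
  finally show "\<delta> (\<alpha> + 1) (homotopy \<alpha> x) G = x G" .
qed (rule x)

section \<open>Homology of the complex\<close>

lemma Davis_index_0: "Davis_index n 0 = {{}}"
  using finite_innermost by (auto simp: Davis_index_def innermost_def)

lemma diff_term_empty:
  assumes "s \<in> {1..<n}"
  shows "diff_term x {} s = x {s}"
  using assms by (simp add: diff_term_def signed_def innermost_def)

lemma singleton_index: "s \<in> {1..<n} \<Longrightarrow> {s} \<in> Davis_index n 1"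
  by (simp add: Davis_index_def innermost_def)

text \<open>Words with a cup have augmentation zero, which gives one inclusion. For the other, the
  same homotopy works in degree 0: by \<open>sum_pr\<close> it misses \<open>x {}\<close> only by
  the scalar part, and that is zero by assumption.\<close>

lemma boundaries_0: "boundaries D \<delta> 0 = {x \<in> carrier (D 0). TL_augmentation (x {}) = \<zero>}"
proof
  have idx: "{} \<in> Davis_index n (1 - 1)" by (simp add: Davis_index_0)
  show "boundaries D \<delta> 0 \<subseteq> {x \<in> carrier (D 0). TL_augmentation (x {}) = \<zero>}"
  proof
    fix y assume "y \<in> boundaries D \<delta> 0"
    then obtain x where x: "x \<in> carrier (D 1)" "y = \<delta> 1 x" by (auto simp: boundaries_def)
    have "TL_augmentation (diff_term x {} s) = \<zero>" if "s \<in> {1..<n}" for s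
      using that augmentation_Cup[OF Davis_cup[OF x(1) singleton_index[OF that]]]
        Davis_indexD(1)[OF singleton_index[OF that]] by (simp add: diff_term_empty)
    then have "TL_augmentation (y {}) = \<zero>"
      unfolding x(2) Davis_diff_apply[OF x(1) idx]
      using diff_term_closed[OF x(1) idx]
      by (subst augmentation.hom_finsum) (simp_all, intro add.finprod_one_eqI, simp)
    then show "y \<in> {x \<in> carrier (D 0). TL_augmentation (x {}) = \<zero>}"
      using Davis_diff_closed[OF x(1)] x(2) by simp
  qed
  show "{x \<in> carrier (D 0). TL_augmentation (x {}) = \<zero>} \<subseteq> boundaries D \<delta> 0"
  proof clarify
    fix x assume x: "x \<in> carrier (D 0)" and aug: "TL_augmentation (x {}) = \<zero>"
    have xc: "x {} \<in> carrier T" using Davis_closed[OF x] by (simp add: Davis_index_0)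
    have h: "homotopy 0 x \<in> carrier (D 1)" using homotopy_closed[OF x] by simp
    have "\<delta> 1 (homotopy 0 x) = x"
    proof (rule Davis_ext)
      show "\<delta> 1 (homotopy 0 x) \<in> carrier (D 0)" using Davis_diff_closed[OF h] by simp
      fix G assume "G \<in> Davis_index n 0"
      then have G: "G = {}" by (simp add: Davis_index_0)
      have "\<delta> 1 (homotopy 0 x) {} = (\<Oplus>\<^bsub>T\<^esub>s\<in>{1..<n}. diff_term (homotopy 0 x) {} s)"
        by (rule Davis_diff_apply[OF h idx])
      also have "\<dots> = (\<Oplus>\<^bsub>T\<^esub>s\<in>{1..<n}. pr s (x {}))"
        using xc by (intro T.finsum_cong') (simp_all add: diff_term_empty homotopy_def singleton_index)
      also have "\<dots> = x {}"
      proof -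
        have "monomial R \<zero> [] = \<zero>\<^bsub>A\<^esub>" by (auto simp: monomial_def free_algebra_def)
        then show ?thesis using sum_pr[OF xc] xc by (simp add: aug word_def T.finsum_closed)
      qed
      finally show "\<delta> 1 (homotopy 0 x) G = x G" by (simp add: G)
    qed (rule x)
    then show "x \<in> boundaries D \<delta> 0" using h by (force simp: boundaries_def)
  qed
qed

lemma trivial_left_module: "left_module T (TL_trivial_module R)"
proof (rule left_moduleI[OF T.ring_axioms])
  show "abelian_group (TL_trivial_module R)"
    by (rule abelian_groupI) (auto simp: TL_trivial_module_def a_ac intro: l_neg)
qed (auto simp: TL_trivial_module_def l_distr r_distr m_assoc)

theorem homology_0: "left_module_isomorphic T (homology_module D \<delta> 0) (TL_trivial_module R)"
proof -
  have "cycles D \<delta> 0 = carrier (D 0)"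
  proof -
    \<comment> \<open>No set has cardinality -1, so degree -1 has a single element, and every
      element of degree 0 is a cycle.\<close>
    have "\<delta> 0 x = \<zero>\<^bsub>D (- 1)\<^esub>" if "x \<in> carrier (D 0)" for x
      using Davis_diff_closed[OF that]
      by (intro Davis_ext[of _ "- 1"]) (auto simp: Davis_index_def)
    then show ?thesis by (auto simp: cycles_def)
  qed
  then have H: "homology_module D \<delta> 0 = quotient_module (D 0) (boundaries D \<delta> 0)"
    by (simp add: homology_module_def)
  define h where "h x = TL_augmentation (x {})" for x :: "nat set \<Rightarrow> (nat list \<Rightarrow> 'a) set"
  have idx: "{} \<in> Davis_index n 0" by (simp add: Davis_index_0)
  have "h \<in> left_module_hom T (D 0) (TL_trivial_module R)"
    unfolding left_module_hom_def
    using Davis_closed[OF _ idx] by (auto simp: h_def TL_trivial_module_def Davis_apply[OF idx])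
  moreover have "h ` carrier (D 0) = carrier (TL_trivial_module R)"
  proof
    show "h ` carrier (D 0) \<subseteq> carrier (TL_trivial_module R)"
      using Davis_closed[OF _ idx] by (auto simp: h_def TL_trivial_module_def)
    show "carrier (TL_trivial_module R) \<subseteq> h ` carrier (D 0)"
    proof
      fix r assume "r \<in> carrier (TL_trivial_module R)"
      then have r: "r \<in> carrier R" by (simp add: TL_trivial_module_def)
      define x where "x = (\<lambda>F\<in>Davis_index n 0. word r [])"
      have "x \<in> carrier (D 0)"
        using r by (auto simp: x_def Davis_carrier Davis_index_0 intro!: word_in_Cup)
      moreover have "h x = r" using r idx by (simp add: h_def x_def augmentation_word)
      ultimately show "r \<in> h ` carrier (D 0)" by blast
    qed
  qed
  ultimately show ?thesis
    using left_module_isomorphic_quotient[OF Davis_left_module trivial_left_module, of h 0]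
    by (simp add: H boundaries_0 h_def TL_trivial_module_def)
qed

theorem homology_positive:
  assumes "\<alpha> > 0"
  shows "carrier (homology_module D \<delta> \<alpha>) = {\<zero>\<^bsub>homology_module D \<delta> \<alpha>\<^esub>}"
proof -
  let ?B = "boundaries D \<delta> \<alpha>"
  have hom: "\<delta> \<alpha> (x \<oplus>\<^bsub>D \<alpha>\<^esub> y) = \<delta> \<alpha> x \<oplus>\<^bsub>D (\<alpha> - 1)\<^esub> \<delta> \<alpha> y"
    if "x \<in> carrier (D \<alpha>)" "y \<in> carrier (D \<alpha>)" for x y \<alpha>
    using Davis_diff_hom that by (simp add: left_module_hom_def)
  have B: "?B = cycles D \<delta> \<alpha>"
  proof
    show "?B \<subseteq> cycles D \<delta> \<alpha>"
      using Davis_diff_closed[of _ "\<alpha> + 1"] Davis_diff_diff[of _ "\<alpha> + 1"]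
      by (auto simp: boundaries_def cycles_def)
    show "cycles D \<delta> \<alpha> \<subseteq> ?B"
      using cycle_is_boundary[OF _ assms] homotopy_closed[of _ \<alpha>] assms
      by (force simp: boundaries_def cycles_def)
  qed
  let ?M = "(D \<alpha>)\<lparr>carrier := cycles D \<delta> \<alpha>\<rparr>"
  have zero: "\<zero>\<^bsub>D \<alpha>\<^esub> \<in> ?B"
  proof -
    have "\<delta> (\<alpha> + 1) \<zero>\<^bsub>D (\<alpha> + 1)\<^esub> \<oplus>\<^bsub>D \<alpha>\<^esub> \<delta> (\<alpha> + 1) \<zero>\<^bsub>D (\<alpha> + 1)\<^esub> = \<delta> (\<alpha> + 1) \<zero>\<^bsub>D (\<alpha> + 1)\<^esub>"
      using hom[of "\<zero>\<^bsub>D (\<alpha> + 1)\<^esub>" "\<alpha> + 1" "\<zero>\<^bsub>D (\<alpha> + 1)\<^esub>"] by simp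
    then have "\<delta> (\<alpha> + 1) \<zero>\<^bsub>D (\<alpha> + 1)\<^esub> = \<zero>\<^bsub>D \<alpha>\<^esub>"
      using Davis_diff_closed[of "\<zero>\<^bsub>D (\<alpha> + 1)\<^esub>" "\<alpha> + 1"] by simp
    then show ?thesis unfolding boundaries_def using D.M.zero_closed by (metis imageI)
  qed
  \<comment> \<open>Restricting the carrier to cycles leaves the addition of
    \<open>D \<alpha>\<close> unchanged. Since the boundaries are all the cycles, the only coset is
    that of zero.\<close>
  have coset: "?B +>\<^bsub>?M\<^esub> x = ?B" if x: "x \<in> ?B" for x
  proof -
    have B': "y \<in> ?B \<longleftrightarrow> y \<in> carrier (D \<alpha>) \<and> \<delta> \<alpha> y = \<zero>\<^bsub>D (\<alpha> - 1)\<^esub>" for y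
      unfolding B cycles_def by simp
    have xc: "x \<in> carrier (D \<alpha>)" using x B' by blast
    have add: "y \<oplus>\<^bsub>D \<alpha>\<^esub> x \<in> ?B" if "y \<in> ?B" for y
      using that x by (simp add: B' hom)
    have "y \<in> ?B +>\<^bsub>?M\<^esub> x" if y: "y \<in> ?B" for y
    proof -
      let ?z = "y \<oplus>\<^bsub>D \<alpha>\<^esub> \<ominus>\<^bsub>D \<alpha>\<^esub> x"
      have yc: "y \<in> carrier (D \<alpha>)" using y B' by blast
      have z: "?z \<in> carrier (D \<alpha>)" "?z \<oplus>\<^bsub>D \<alpha>\<^esub> x = y"
        using xc yc by (simp_all add: D.M.a_assoc D.M.l_neg)
      have "\<delta> \<alpha> ?z = \<delta> \<alpha> ?z \<oplus>\<^bsub>D (\<alpha> - 1)\<^esub> \<delta> \<alpha> x"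
        using x Davis_diff_closed[OF z(1)] by (simp add: B')
      also have "\<dots> = \<delta> \<alpha> y" using hom[OF z(1) xc] z(2) by simp
      finally have "?z \<in> ?B" using z(1) y by (simp add: B')
      then show ?thesis using z(2) by (force simp: a_r_coset_def')
    qed
    moreover have "?B +>\<^bsub>?M\<^esub> x \<subseteq> ?B" using add by (auto simp: a_r_coset_def')
    ultimately show ?thesis by blast
  qed
  have "carrier (homology_module D \<delta> \<alpha>) = (\<lambda>x. ?B +>\<^bsub>?M\<^esub> x) ` ?B"
    by (auto simp: homology_module_def quotient_module_def A_RCOSETS_def' B)
  also have "\<dots> = {?B}" using coset zero by (auto simp: image_iff)
  finally show ?thesis by (simp add: homology_module_def quotient_module_def)
qed

theorem chain_complex: "left_chain_complex T D \<delta>"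
  unfolding left_chain_complex_def using Davis_left_module Davis_diff_hom Davis_diff_diff by blast

end

theorem theoremD:
  fixes R :: "('r, 'm) ring_scheme" and a :: 'r and n :: nat
  assumes "cring R" and "a \<in> carrier R"
  shows "left_chain_complex (TL R n a) (Davis R n a) (Davis_diff R n a) \<and>
    (\<forall>\<alpha>>0. carrier (homology_module (Davis R n a) (Davis_diff R n a) \<alpha>) =
        {\<zero>\<^bsub>homology_module (Davis R n a) (Davis_diff R n a) \<alpha>\<^esub>}) \<and>
    left_module_isomorphic (TL R n a)
      (homology_module (Davis R n a) (Davis_diff R n a) 0) (TL_trivial_module R)"
proof -
  interpret temperley_lieb R n a
    using assms by (simp add: temperley_lieb_def temperley_lieb_axioms_def)
  show ?thesis using chain_complex homology_positive homology_0 by blast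
qed

end
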